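(* Let $L$ be a (left) Leibniz algebra over $\mathfrak{k}$ with left center $Z$, let $S^\bullet(Z)$ be the symmetric algebra of $Z$, and let $\mathcal{L}=S^{\bullet}(Z)\otimes L$ (write $fe$ for $f\otimes e$), regarded as an $S^\bullet(Z)$-module by multiplication on the first factor. Define (i) $\langle f_1e_1,f_2e_2\rangle=f_1f_2(e_1,e_2)$, where $(e_1,e_2)=e_1\circ e_2+e_2\circ e_1\in Z$; (ii) $\partial:S^\bullet(Z)\to\mathcal{L}$, the derivation extending the inclusion $Z\hookrightarrow L$, i.e. $\partial(z_1\cdots z_k)=\sum_{i=1}^k(z_1\cdots\widehat{z_i}\cdots z_k)\,\partial z_i$ with $\partial z=1\otimes z$ for $z\in Z$; (iii) the bracket $f_1e_1\circ f_2e_2=f_1f_2(e_1\circ e_2)+\langle e_1,e_2\rangle f_2\,\partial f_1+\langle e_1,\partial f_2\rangle f_1e_2-\langle e_2,\partial f_1\rangle f_2e_1$, for $f_1,f_2\in S^\bullet(Z)$, $e_1,e_2\in L$, $z_i\in Z$. Then $(\mathcal{L},S^{\bullet}(Z),\langle\cdot,\cdot\rangle,\partial,\circ)$ is a Courant-Dorfman algebra.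
   Context: Throughout $\mathfrak{k}=\mathbb{R}$ or $\mathbb{C}$; a hat denotes omission. A (left) Leibniz algebra is a $\mathfrak{k}$-vector space $L$ with a bilinear bracket $\circ$ satisfying $e_1\circ(e_2\circ e_3)=(e_1\circ e_2)\circ e_3+e_2\circ(e_1\circ e_3)$. Its left center is $Z=\{e\in L: e\circ e'=0\ \forall e'\in L\}$; one has $e_1\circ e_2+e_2\circ e_1\in Z$ for all $e_1,e_2\in L$. A Courant-Dorfman algebra $(\mathcal{E},R,\langle\cdot,\cdot\rangle,\partial,\circ)$ consists of a commutative $\mathfrak{k}$-algebra $R$, an $R$-module $\mathcal{E}$, a symmetric $R$-bilinear form $\langle\cdot,\cdot\rangle:\mathcal{E}\otimes_R\mathcal{E}\to R$ (not assumed non-degenerate), a derivation $\partial:R\to\mathcal{E}$ and a $\mathfrak{k}$-bilinear bracket $\circ:\mathcal{E}\otimes\mathcal{E}\to\mathcal{E}$ such that for all $e,e_i\in\mathcal{E}$, $f,g\in R$: (1) $e_1\circ(fe_2)=f(e_1\circ e_2)+\langle e_1,\partial f\rangle e_2$; (2) $\langle e_1,\partial\langle e_2,e_3\rangle\rangle=\langle e_1\circ e_2,e_3\rangle+\langle e_2,e_1\circ e_3\rangle$; (3) $e_1\circ e_2+e_2\circ e_1=\partial\langle e_1,e_2\rangle$; (4) $e_1\circ(e_2\circ e_3)=(e_1\circ e_2)\circ e_3+e_2\circ(e_1\circ e_3)$; (5) $\partial f\circ e=0$; (6) $\langle\partial f,\partial g\rangle=0$. *)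

theory Defs
  imports
    Complex_Main
    "HOL-Library.Multiset"
    "HOL-Library.Poly_Mapping"
    "HOL-Algebra.Module"
    "HOL-Algebra.QuotRing"
    "HOL-Algebra.Generated_Groups"
    "HOL-Algebra.Free_Abelian_Groups"
begin

section \<open>Scalars\<close>

text \<open>
  The class \<^class>\<open>real_normed_field\<close> has the two instances \<^typ>\<open>real\<close> and \<^typ>\<open>complex\<close>; by
  the Gelfand-Mazur theorem every type of this class is, as a field, one of these two.
\<close>

definition scalars :: "'k::real_normed_field ring" where
  "scalars = \<lparr>carrier = UNIV, monoid.mult = (*), monoid.one = 1, ring.zero = 0, ring.add = (+)\<rparr>"


section \<open>Leibniz algebras\<close>

locale leibniz_algebra = module K L
  for K :: "('k, 'm) ring_scheme" (structure)
    and L :: "('k, 'l, 'n) module_scheme" (structure) +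
  fixes lb :: "'l \<Rightarrow> 'l \<Rightarrow> 'l"
  assumes lb_closed:
      "\<lbrakk>x \<in> carrier L; y \<in> carrier L\<rbrakk> \<Longrightarrow> lb x y \<in> carrier L"
    and lb_add_left:
      "\<lbrakk>x \<in> carrier L; x' \<in> carrier L; y \<in> carrier L\<rbrakk>
        \<Longrightarrow> lb (x \<oplus>\<^bsub>L\<^esub> x') y = lb x y \<oplus>\<^bsub>L\<^esub> lb x' y"
    and lb_add_right:
      "\<lbrakk>x \<in> carrier L; y \<in> carrier L; y' \<in> carrier L\<rbrakk>
        \<Longrightarrow> lb x (y \<oplus>\<^bsub>L\<^esub> y') = lb x y \<oplus>\<^bsub>L\<^esub> lb x y'"
    and lb_smult_left:
      "\<lbrakk>c \<in> carrier K; x \<in> carrier L; y \<in> carrier L\<rbrakk>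
        \<Longrightarrow> lb (c \<odot>\<^bsub>L\<^esub> x) y = c \<odot>\<^bsub>L\<^esub> lb x y"
    and lb_smult_right:
      "\<lbrakk>c \<in> carrier K; x \<in> carrier L; y \<in> carrier L\<rbrakk>
        \<Longrightarrow> lb x (c \<odot>\<^bsub>L\<^esub> y) = c \<odot>\<^bsub>L\<^esub> lb x y"
    and leibniz_identity:
      "\<lbrakk>x \<in> carrier L; y \<in> carrier L; z \<in> carrier L\<rbrakk>
        \<Longrightarrow> lb x (lb y z) = lb (lb x y) z \<oplus>\<^bsub>L\<^esub> lb y (lb x z)"

definition left_center :: "('k, 'l, 'n) module_scheme \<Rightarrow> ('l \<Rightarrow> 'l \<Rightarrow> 'l) \<Rightarrow> 'l set" where
  "left_center L lb = {x \<in> carrier L. \<forall>y \<in> carrier L. lb x y = \<zero>\<^bsub>L\<^esub>}"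

definition pairing :: "('k, 'l, 'n) module_scheme \<Rightarrow> ('l \<Rightarrow> 'l \<Rightarrow> 'l) \<Rightarrow> 'l \<Rightarrow> 'l \<Rightarrow> 'l" where
  "pairing L lb x y = lb x y \<oplus>\<^bsub>L\<^esub> lb y x"


section \<open>Courant-Dorfman algebras\<close>

text \<open>An \<open>R\<close>-module is a vector space over \<open>K\<close> by restriction of scalars along \<open>c \<mapsto> c \<odot> 1\<close>.\<close>

definition res_smult ::
    "('k, 'r, 'p) module_scheme \<Rightarrow> ('r, 'e, 'q) module_scheme \<Rightarrow> 'k \<Rightarrow> 'e \<Rightarrow> 'e" where
  "res_smult R E c x = (c \<odot>\<^bsub>R\<^esub> \<one>\<^bsub>R\<^esub>) \<odot>\<^bsub>E\<^esub> x"

definition derivation ::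
    "('k, 'm) ring_scheme \<Rightarrow> ('k, 'r, 'p) module_scheme \<Rightarrow> ('r, 'e, 'q) module_scheme
      \<Rightarrow> ('r \<Rightarrow> 'e) \<Rightarrow> bool" where
  "derivation K R E d \<longleftrightarrow>
     d \<in> carrier R \<rightarrow> carrier E \<and>
     (\<forall>f \<in> carrier R. \<forall>g \<in> carrier R. d (f \<oplus>\<^bsub>R\<^esub> g) = d f \<oplus>\<^bsub>E\<^esub> d g) \<and>
     (\<forall>c \<in> carrier K. \<forall>f \<in> carrier R. d (c \<odot>\<^bsub>R\<^esub> f) = res_smult R E c (d f)) \<and>
     (\<forall>f \<in> carrier R. \<forall>g \<in> carrier R.
        d (f \<otimes>\<^bsub>R\<^esub> g) = f \<odot>\<^bsub>E\<^esub> d g \<oplus>\<^bsub>E\<^esub> g \<odot>\<^bsub>E\<^esub> d f)"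

locale courant_dorfman_algebra = algebra K R + E: module R E
  for K :: "('k, 'm) ring_scheme" (structure)
    and R :: "('k, 'r, 'p) module_scheme" (structure)
    and E :: "('r, 'e, 'q) module_scheme" (structure) +
  fixes ip :: "'e \<Rightarrow> 'e \<Rightarrow> 'r"
    and d :: "'r \<Rightarrow> 'e"
    and br :: "'e \<Rightarrow> 'e \<Rightarrow> 'e"
  assumes ip_closed:
      "\<lbrakk>x \<in> carrier E; y \<in> carrier E\<rbrakk> \<Longrightarrow> ip x y \<in> carrier R"
    and ip_sym:
      "\<lbrakk>x \<in> carrier E; y \<in> carrier E\<rbrakk> \<Longrightarrow> ip x y = ip y x"
    and ip_add:
      "\<lbrakk>x \<in> carrier E; x' \<in> carrier E; y \<in> carrier E\<rbrakk>
        \<Longrightarrow> ip (x \<oplus>\<^bsub>E\<^esub> x') y = ip x y \<oplus>\<^bsub>R\<^esub> ip x' y"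
    and ip_smult:
      "\<lbrakk>f \<in> carrier R; x \<in> carrier E; y \<in> carrier E\<rbrakk>
        \<Longrightarrow> ip (f \<odot>\<^bsub>E\<^esub> x) y = f \<otimes>\<^bsub>R\<^esub> ip x y"
    and derivation: "derivation K R E d"
    and br_closed:
      "\<lbrakk>x \<in> carrier E; y \<in> carrier E\<rbrakk> \<Longrightarrow> br x y \<in> carrier E"
    and br_add_left:
      "\<lbrakk>x \<in> carrier E; x' \<in> carrier E; y \<in> carrier E\<rbrakk>
        \<Longrightarrow> br (x \<oplus>\<^bsub>E\<^esub> x') y = br x y \<oplus>\<^bsub>E\<^esub> br x' y"
    and br_add_right:
      "\<lbrakk>x \<in> carrier E; y \<in> carrier E; y' \<in> carrier E\<rbrakk>
        \<Longrightarrow> br x (y \<oplus>\<^bsub>E\<^esub> y') = br x y \<oplus>\<^bsub>E\<^esub> br x y'"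
    and br_smult_left:
      "\<lbrakk>c \<in> carrier K; x \<in> carrier E; y \<in> carrier E\<rbrakk>
        \<Longrightarrow> br (res_smult R E c x) y = res_smult R E c (br x y)"
    and br_smult_right:
      "\<lbrakk>c \<in> carrier K; x \<in> carrier E; y \<in> carrier E\<rbrakk>
        \<Longrightarrow> br x (res_smult R E c y) = res_smult R E c (br x y)"
    and br_module_smult:
      "\<lbrakk>f \<in> carrier R; x \<in> carrier E; y \<in> carrier E\<rbrakk>
        \<Longrightarrow> br x (f \<odot>\<^bsub>E\<^esub> y) = f \<odot>\<^bsub>E\<^esub> br x y \<oplus>\<^bsub>E\<^esub> ip x (d f) \<odot>\<^bsub>E\<^esub> y"
    and ip_invariant:
      "\<lbrakk>x \<in> carrier E; y \<in> carrier E; z \<in> carrier E\<rbrakk>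
        \<Longrightarrow> ip x (d (ip y z)) = ip (br x y) z \<oplus>\<^bsub>R\<^esub> ip y (br x z)"
    and br_symmetrized:
      "\<lbrakk>x \<in> carrier E; y \<in> carrier E\<rbrakk> \<Longrightarrow> br x y \<oplus>\<^bsub>E\<^esub> br y x = d (ip x y)"
    and br_leibniz:
      "\<lbrakk>x \<in> carrier E; y \<in> carrier E; z \<in> carrier E\<rbrakk>
        \<Longrightarrow> br x (br y z) = br (br x y) z \<oplus>\<^bsub>E\<^esub> br y (br x z)"
    and br_d_left:
      "\<lbrakk>f \<in> carrier R; x \<in> carrier E\<rbrakk> \<Longrightarrow> br (d f) x = \<zero>\<^bsub>E\<^esub>"
    and ip_d_d:
      "\<lbrakk>f \<in> carrier R; g \<in> carrier R\<rbrakk> \<Longrightarrow> ip (d f) (d g) = \<zero>\<^bsub>R\<^esub>"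


section \<open>The symmetric algebra of a vector space\<close>

text \<open>
  The symmetric algebra of \<open>V\<close> is the polynomial algebra with one variable for each vector of
  \<open>V\<close>, modulo the ideal that makes the map sending a vector to its variable linear. Monomials are
  multisets of variables, polynomials are finitely supported functions on monomials, and
  \<open>(*)\<close> on them is convolution.
\<close>

definition free_comm_algebra :: "'v set \<Rightarrow> ('k::real_normed_field, 'v multiset \<Rightarrow>\<^sub>0 'k) module" where
  "free_comm_algebra X =
     \<lparr>carrier = {p. \<forall>m \<in> Poly_Mapping.keys p. set_mset m \<subseteq> X},
      monoid.mult = (*), monoid.one = 1, ring.zero = 0, ring.add = (+),
      smult = (\<lambda>c p. Poly_Mapping.single {#} c * p)\<rparr>"

definition poly_var :: "'v \<Rightarrow> ('v multiset \<Rightarrow>\<^sub>0 'k::real_normed_field)" where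
  "poly_var v = Poly_Mapping.single {#v#} 1"

definition sym_relations ::
    "('k::real_normed_field, 'v, 'n) module_scheme \<Rightarrow> ('v multiset \<Rightarrow>\<^sub>0 'k) set" where
  "sym_relations V =
     {poly_var (v \<oplus>\<^bsub>V\<^esub> w) - poly_var v - poly_var w | v w. v \<in> carrier V \<and> w \<in> carrier V} \<union>
     {poly_var (c \<odot>\<^bsub>V\<^esub> v) - Poly_Mapping.single {#} c * poly_var v | c v. v \<in> carrier V}"

definition sym_ideal ::
    "('k::real_normed_field, 'v, 'n) module_scheme \<Rightarrow> ('v multiset \<Rightarrow>\<^sub>0 'k) set" where
  "sym_ideal V = genideal (free_comm_algebra (carrier V)) (sym_relations V)"

definition sym_algebra ::
    "('k::real_normed_field, 'v, 'n) module_scheme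
      \<Rightarrow> ('k, ('v multiset \<Rightarrow>\<^sub>0 'k) set) module" where
  "sym_algebra V =
     (let P = free_comm_algebra (carrier V); Q = P Quot sym_ideal V in
     \<lparr>carrier = carrier Q, monoid.mult = monoid.mult Q, monoid.one = monoid.one Q,
      ring.zero = ring.zero Q, ring.add = ring.add Q,
      smult = (\<lambda>c A. (sym_ideal V +>\<^bsub>P\<^esub> (c \<odot>\<^bsub>P\<^esub> \<one>\<^bsub>P\<^esub>)) \<otimes>\<^bsub>Q\<^esub> A)\<rparr>)"

definition sym_incl ::
    "('k::real_normed_field, 'v, 'n) module_scheme \<Rightarrow> 'v \<Rightarrow> ('v multiset \<Rightarrow>\<^sub>0 'k) set" where
  "sym_incl V v = sym_ideal V +>\<^bsub>free_comm_algebra (carrier V)\<^esub> poly_var v"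


section \<open>Tensor products\<close>

text \<open>
  The tensor product over \<open>K\<close> is the free abelian group on the pairs \<open>(a, b)\<close>, modulo the subgroup
  generated by the biadditivity and \<open>K\<close>-balancing relations. The library's
  \<^const>\<open>free_Abelian_group\<close> is a multiplicative group record whose operation is \<open>(+)\<close> on
  finitely supported functions.
\<close>

definition tensor_relations ::
    "('k, 'm) ring_scheme \<Rightarrow> ('k, 'a, 'p) module_scheme \<Rightarrow> ('k, 'b, 'q) module_scheme
      \<Rightarrow> ('a \<times> 'b \<Rightarrow>\<^sub>0 int) set" where
  "tensor_relations K A B =
     {frag_of (a \<oplus>\<^bsub>A\<^esub> a', b) - frag_of (a, b) - frag_of (a', b) | a a' b.
        a \<in> carrier A \<and> a' \<in> carrier A \<and> b \<in> carrier B} \<union>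
     {frag_of (a, b \<oplus>\<^bsub>B\<^esub> b') - frag_of (a, b) - frag_of (a, b') | a b b'.
        a \<in> carrier A \<and> b \<in> carrier B \<and> b' \<in> carrier B} \<union>
     {frag_of (c \<odot>\<^bsub>A\<^esub> a, b) - frag_of (a, c \<odot>\<^bsub>B\<^esub> b) | c a b.
        c \<in> carrier K \<and> a \<in> carrier A \<and> b \<in> carrier B}"

definition tensor_kernel ::
    "('k, 'm) ring_scheme \<Rightarrow> ('k, 'a, 'p) module_scheme \<Rightarrow> ('k, 'b, 'q) module_scheme
      \<Rightarrow> ('a \<times> 'b \<Rightarrow>\<^sub>0 int) set" where
  "tensor_kernel K A B =
     generate (free_Abelian_group (carrier A \<times> carrier B)) (tensor_relations K A B)"

definition pure_tensor ::
    "('k, 'm) ring_scheme \<Rightarrow> ('k, 'a, 'p) module_scheme \<Rightarrow> ('k, 'b, 'q) module_scheme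
      \<Rightarrow> 'a \<Rightarrow> 'b \<Rightarrow> ('a \<times> 'b \<Rightarrow>\<^sub>0 int) set" where
  "pure_tensor K A B a b =
     tensor_kernel K A B #>\<^bsub>free_Abelian_group (carrier A \<times> carrier B)\<^esub> frag_of (a, b)"

text \<open>
  For a \<open>K\<close>-algebra \<open>A\<close>, the tensor product of \<open>A\<close> and \<open>B\<close> as an \<open>A\<close>-module: on representatives, \<open>f\<close>
  replaces each \<open>(a, b)\<close> by \<open>(f a, b)\<close>. The multiplicative fields of the record, which every
  \<open>module\<close> record carries, are irrelevant for a module.
\<close>

definition tensor_module ::
    "('k, 'm) ring_scheme \<Rightarrow> ('k, 'a, 'p) module_scheme \<Rightarrow> ('k, 'b, 'q) module_scheme
      \<Rightarrow> ('a, ('a \<times> 'b \<Rightarrow>\<^sub>0 int) set) module" where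
  "tensor_module K A B =
     (let F = free_Abelian_group (carrier A \<times> carrier B); N = tensor_kernel K A B; G = F Mod N in
     \<lparr>carrier = carrier G, monoid.mult = undefined, monoid.one = undefined,
      ring.zero = monoid.one G, ring.add = monoid.mult G,
      smult = (\<lambda>f X. \<Union>x\<in>X. N #>\<^bsub>F\<^esub> frag_extend (\<lambda>(a, b). frag_of (f \<otimes>\<^bsub>A\<^esub> a, b)) x)\<rparr>)"


section \<open>The structure on the tensor product of the symmetric algebra of the left center with the Leibniz algebra\<close>

definition center_module ::
    "('k, 'l) module \<Rightarrow> ('l \<Rightarrow> 'l \<Rightarrow> 'l) \<Rightarrow> ('k, 'l) module" where
  "center_module L lb = L\<lparr>carrier := left_center L lb\<rparr>"

abbreviation center_sym ::
    "('k::real_normed_field, 'l) module \<Rightarrow> ('l \<Rightarrow> 'l \<Rightarrow> 'l)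
      \<Rightarrow> ('k, ('l multiset \<Rightarrow>\<^sub>0 'k) set) module" where
  "center_sym L lb \<equiv> sym_algebra (center_module L lb)"

abbreviation center_incl ::
    "('k::real_normed_field, 'l) module \<Rightarrow> ('l \<Rightarrow> 'l \<Rightarrow> 'l) \<Rightarrow> 'l \<Rightarrow> ('l multiset \<Rightarrow>\<^sub>0 'k) set" where
  "center_incl L lb \<equiv> sym_incl (center_module L lb)"

abbreviation ext_module ::
    "('k::real_normed_field, 'l) module \<Rightarrow> ('l \<Rightarrow> 'l \<Rightarrow> 'l)
      \<Rightarrow> (('l multiset \<Rightarrow>\<^sub>0 'k) set, (('l multiset \<Rightarrow>\<^sub>0 'k) set \<times> 'l \<Rightarrow>\<^sub>0 int) set) module" where
  "ext_module L lb \<equiv> tensor_module scalars (center_sym L lb) L"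

abbreviation ext_tensor ::
    "('k::real_normed_field, 'l) module \<Rightarrow> ('l \<Rightarrow> 'l \<Rightarrow> 'l) \<Rightarrow> ('l multiset \<Rightarrow>\<^sub>0 'k) set \<Rightarrow> 'l
      \<Rightarrow> (('l multiset \<Rightarrow>\<^sub>0 'k) set \<times> 'l \<Rightarrow>\<^sub>0 int) set" where
  "ext_tensor L lb \<equiv> pure_tensor scalars (center_sym L lb) L"

definition biadditive ::
    "('a, 'm) ring_scheme \<Rightarrow> ('b, 'n) ring_scheme \<Rightarrow> ('a \<Rightarrow> 'a \<Rightarrow> 'b) \<Rightarrow> bool" where
  "biadditive A B h \<longleftrightarrow>
     (\<forall>x \<in> carrier A. \<forall>y \<in> carrier A. h x y \<in> carrier B) \<and>
     (\<forall>x \<in> carrier A. \<forall>x' \<in> carrier A. \<forall>y \<in> carrier A.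
        h (x \<oplus>\<^bsub>A\<^esub> x') y = h x y \<oplus>\<^bsub>B\<^esub> h x' y) \<and>
     (\<forall>x \<in> carrier A. \<forall>y \<in> carrier A. \<forall>y' \<in> carrier A.
        h x (y \<oplus>\<^bsub>A\<^esub> y') = h x y \<oplus>\<^bsub>B\<^esub> h x y')"

text \<open>
  The defining formulas prescribe the form and the bracket on pure tensors only; biadditivity
  determines them on all of the tensor product.
\<close>

definition is_ext_form ::
    "('k::real_normed_field, 'l) module \<Rightarrow> ('l \<Rightarrow> 'l \<Rightarrow> 'l)
      \<Rightarrow> ((('l multiset \<Rightarrow>\<^sub>0 'k) set \<times> 'l \<Rightarrow>\<^sub>0 int) set
          \<Rightarrow> (('l multiset \<Rightarrow>\<^sub>0 'k) set \<times> 'l \<Rightarrow>\<^sub>0 int) set \<Rightarrow> ('l multiset \<Rightarrow>\<^sub>0 'k) set) \<Rightarrow> bool" where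
  "is_ext_form L lb ip \<longleftrightarrow>
     (let S = center_sym L lb; T = ext_module L lb; t = ext_tensor L lb in
     biadditive T S ip \<and>
     (\<forall>f1 \<in> carrier S. \<forall>f2 \<in> carrier S. \<forall>e1 \<in> carrier L. \<forall>e2 \<in> carrier L.
        ip (t f1 e1) (t f2 e2) = f1 \<otimes>\<^bsub>S\<^esub> f2 \<otimes>\<^bsub>S\<^esub> center_incl L lb (pairing L lb e1 e2)))"

definition is_ext_derivation ::
    "('k::real_normed_field, 'l) module \<Rightarrow> ('l \<Rightarrow> 'l \<Rightarrow> 'l)
      \<Rightarrow> (('l multiset \<Rightarrow>\<^sub>0 'k) set \<Rightarrow> (('l multiset \<Rightarrow>\<^sub>0 'k) set \<times> 'l \<Rightarrow>\<^sub>0 int) set) \<Rightarrow> bool" where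
  "is_ext_derivation L lb d \<longleftrightarrow>
     (let S = center_sym L lb; T = ext_module L lb; t = ext_tensor L lb; \<iota> = center_incl L lb in
     derivation scalars S T d \<and>
     (\<forall>z \<in> left_center L lb. d (\<iota> z) = t \<one>\<^bsub>S\<^esub> z) \<and>
     (\<forall>k::nat. \<forall>z. (\<forall>i<k. z i \<in> left_center L lb) \<longrightarrow>
        d (\<Otimes>\<^bsub>S\<^esub>i \<in> {..<k}. \<iota> (z i)) =
          (\<Oplus>\<^bsub>T\<^esub>i \<in> {..<k}. (\<Otimes>\<^bsub>S\<^esub>j \<in> {..<k} - {i}. \<iota> (z j)) \<odot>\<^bsub>T\<^esub> d (\<iota> (z i)))))"

text \<open>In the last formula a vector \<open>e\<close> of \<open>L\<close> stands for the pure tensor of \<open>1\<close> and \<open>e\<close>.\<close>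

definition is_ext_bracket ::
    "('k::real_normed_field, 'l) module \<Rightarrow> ('l \<Rightarrow> 'l \<Rightarrow> 'l)
      \<Rightarrow> ((('l multiset \<Rightarrow>\<^sub>0 'k) set \<times> 'l \<Rightarrow>\<^sub>0 int) set
          \<Rightarrow> (('l multiset \<Rightarrow>\<^sub>0 'k) set \<times> 'l \<Rightarrow>\<^sub>0 int) set \<Rightarrow> ('l multiset \<Rightarrow>\<^sub>0 'k) set)
      \<Rightarrow> (('l multiset \<Rightarrow>\<^sub>0 'k) set \<Rightarrow> (('l multiset \<Rightarrow>\<^sub>0 'k) set \<times> 'l \<Rightarrow>\<^sub>0 int) set)
      \<Rightarrow> ((('l multiset \<Rightarrow>\<^sub>0 'k) set \<times> 'l \<Rightarrow>\<^sub>0 int) set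
          \<Rightarrow> (('l multiset \<Rightarrow>\<^sub>0 'k) set \<times> 'l \<Rightarrow>\<^sub>0 int) set
          \<Rightarrow> (('l multiset \<Rightarrow>\<^sub>0 'k) set \<times> 'l \<Rightarrow>\<^sub>0 int) set) \<Rightarrow> bool" where
  "is_ext_bracket L lb ip d br \<longleftrightarrow>
     (let S = center_sym L lb; T = ext_module L lb; t = ext_tensor L lb; u = t \<one>\<^bsub>S\<^esub> in
     biadditive T T br \<and>
     (\<forall>f1 \<in> carrier S. \<forall>f2 \<in> carrier S. \<forall>e1 \<in> carrier L. \<forall>e2 \<in> carrier L.
        br (t f1 e1) (t f2 e2) =
          (t (f1 \<otimes>\<^bsub>S\<^esub> f2) (lb e1 e2)
           \<oplus>\<^bsub>T\<^esub> (ip (u e1) (u e2) \<otimes>\<^bsub>S\<^esub> f2) \<odot>\<^bsub>T\<^esub> d f1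
           \<oplus>\<^bsub>T\<^esub> t (ip (u e1) (d f2) \<otimes>\<^bsub>S\<^esub> f1) e2)
           \<ominus>\<^bsub>T\<^esub> t (ip (u e2) (d f1) \<otimes>\<^bsub>S\<^esub> f2) e1))"

definition is_ext_structure where
  "is_ext_structure L lb ip d br \<longleftrightarrow>
     is_ext_form L lb ip \<and> is_ext_derivation L lb d \<and> is_ext_bracket L lb ip d br"

end

theory Submission
  imports Defs
begin

text \<open>
  Since \<open>\<L> = S(Z) \<otimes> L\<close> is generated by \<open>L\<close> as an \<open>S(Z)\<close>-module and \<open>S(Z)\<close> is generated by \<open>Z\<close>
  as an algebra, every axiom reduces to generators once it is known how its defect depends on each
  argument. The bracket formula gives the two Leibniz rules and the symmetrization axiom directly.
  The set of \<open>f\<close> with \<open>\<partial>f \<circ> e = 0\<close> for all \<open>e\<close> is a subalgebra containing \<open>Z\<close>, and the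
  invariance defect of the form is trilinear. Together these make the Jacobiator linear in its last
  argument and alternating, so it vanishes because it vanishes on \<open>L\<close>. The derivation exists
  because \<open>p \<mapsto> \<Sum>\<^sub>v (\<partial>p/\<partial>v) \<otimes> v\<close> on polynomials respects the relations of the symmetric algebra.
\<close>


section \<open>Brackets on a module given on generators\<close>

text \<open>The bracket is not \<open>R\<close>-linear in either argument. The defect is governed by
  the operators \<open>\<rho>(x) f = ip x (d f)\<close>, and the order of the axioms is the order in
  which these can be cancelled: isotropy of \<open>d\<close> carries \<open>br (d f) x = 0\<close>
  from generators to all elements, this turns invariance with third argument \<open>d f\<close> into
  the statement that \<rho> takes brackets to commutators, and that is exactly what linearity of the
  Jacobiator in its last argument requires. The form may be degenerate, so none of these identities
  can be obtained by pairing with all elements.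

  On \<open>L\<close> everything comes from one fact: \<open>lb x y + lb y x\<close> lies in the
  left center. Hence \<open>(x, z) = lb x z\<close> for central \<open>z\<close>, and invariance of
  the pairing is the Leibniz identity used twice.

  The formulas for the form and the bracket speak of pure tensors \<open>f \<otimes> e\<close> only,
  so the maps themselves have to be constructed. The bracket formula differentiates
  \<open>f\<close>; it is compatible with moving a scalar across the tensor sign because
  \<open>d\<close> kills scalars.\<close>

text \<open>With this the method \<open>algebra\<close> also normalizes module expressions.\<close>

lemmas (in module) module_simprules
  [algebra add: module "ring.zero R" "ring.add R" "a_inv R" "a_minus R" "monoid.one R" "monoid.mult R" "smult M"] =
  R.cring_simprules
  M.a_closed M.zero_closed M.a_inv_closed M.minus_closed
  M.a_assoc M.l_zero M.l_neg M.a_comm M.minus_eq M.r_zero M.r_neg M.r_neg2 M.r_neg1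
  M.minus_add M.minus_minus M.a_lcomm
  smult_closed smult_l_distr smult_r_distr smult_assoc1 [symmetric] smult_one
  smult_l_null smult_r_null smult_l_minus smult_r_minus

text \<open>
  The bracket of \<open>f e\<close> and \<open>g e'\<close>, where \<open>p = \<langle>e, e'\<rangle>\<close>, \<open>q = \<langle>e, \<partial>g\<rangle>\<close>, \<open>r = \<langle>e', \<partial>f\<rangle>\<close>,
  \<open>X = e \<circ> e'\<close>, \<open>Y = \<partial>f\<close>, \<open>W = e'\<close> and \<open>V = e\<close>. The lemmas below hold without any relation between
  these, which lets \<open>algebra\<close> work on atoms.
\<close>

definition (in module) bracket_terms where
  "bracket_terms f g p q r X Y W V =
    ((f \<otimes> g) \<odot>\<^bsub>M\<^esub> X \<oplus>\<^bsub>M\<^esub> (p \<otimes> g) \<odot>\<^bsub>M\<^esub> Y \<oplus>\<^bsub>M\<^esub> (q \<otimes> f) \<odot>\<^bsub>M\<^esub> W) \<ominus>\<^bsub>M\<^esub> (r \<otimes> g) \<odot>\<^bsub>M\<^esub> V"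

context module begin

context
  fixes f g p q r X Y W V
  assumes R: "f \<in> carrier R" "g \<in> carrier R" "p \<in> carrier R" "q \<in> carrier R" "r \<in> carrier R"
    and M: "X \<in> carrier M" "Y \<in> carrier M" "W \<in> carrier M" "V \<in> carrier M"
begin

lemma bracket_terms_closed: "bracket_terms f g p q r X Y W V \<in> carrier M"
  using R M by (simp add: bracket_terms_def)

text \<open>The four sums express additivity in \<open>f\<close>, \<open>e\<close>, \<open>g\<close>
  and \<open>e'\<close>. Each varies exactly the atoms that depend on that argument:
  \<open>r\<close> and \<open>Y\<close> move with \<open>f\<close>, the atoms \<open>p\<close>,
  \<open>q\<close>, \<open>X\<close>, \<open>V\<close> with \<open>e\<close>, only \<open>q\<close>
  with \<open>g\<close>, and \<open>p\<close>, \<open>r\<close>, \<open>X\<close>, \<open>W\<close>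
  with \<open>e'\<close>.\<close>

lemma bracket_terms_add_1:
  "\<lbrakk>f' \<in> carrier R; r' \<in> carrier R; Y' \<in> carrier M\<rbrakk> \<Longrightarrow>
    bracket_terms (f \<oplus> f') g p q (r \<oplus> r') X (Y \<oplus>\<^bsub>M\<^esub> Y') W V =
    bracket_terms f g p q r X Y W V \<oplus>\<^bsub>M\<^esub> bracket_terms f' g p q r' X Y' W V"
  unfolding bracket_terms_def using R M by algebra

lemma bracket_terms_add_2:
  "\<lbrakk>p' \<in> carrier R; q' \<in> carrier R; X' \<in> carrier M; V' \<in> carrier M\<rbrakk> \<Longrightarrow>
    bracket_terms f g (p \<oplus> p') (q \<oplus> q') r (X \<oplus>\<^bsub>M\<^esub> X') Y W (V \<oplus>\<^bsub>M\<^esub> V') =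
    bracket_terms f g p q r X Y W V \<oplus>\<^bsub>M\<^esub> bracket_terms f g p' q' r X' Y W V'"
  unfolding bracket_terms_def using R M by algebra

lemma bracket_terms_add_3:
  "\<lbrakk>g' \<in> carrier R; q' \<in> carrier R\<rbrakk> \<Longrightarrow>
    bracket_terms f (g \<oplus> g') p (q \<oplus> q') r X Y W V =
    bracket_terms f g p q r X Y W V \<oplus>\<^bsub>M\<^esub> bracket_terms f g' p q' r X Y W V"
  unfolding bracket_terms_def using R M by algebra

lemma bracket_terms_add_4:
  "\<lbrakk>p' \<in> carrier R; r' \<in> carrier R; X' \<in> carrier M; W' \<in> carrier M\<rbrakk> \<Longrightarrow>
    bracket_terms f g (p \<oplus> p') q (r \<oplus> r') (X \<oplus>\<^bsub>M\<^esub> X') Y (W \<oplus>\<^bsub>M\<^esub> W') V =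
    bracket_terms f g p q r X Y W V \<oplus>\<^bsub>M\<^esub> bracket_terms f g p' q r' X' Y W' V"
  unfolding bracket_terms_def using R M by algebra

text \<open>Here \<open>c\<close> stands for a scalar: \<open>d c = 0\<close> gives
  \<open>d (c f) = c d f\<close>, which is why \<open>r\<close> and \<open>Y\<close> scale along
  with \<open>f\<close>.\<close>

lemma bracket_terms_balanced_1:
  "c \<in> carrier R \<Longrightarrow>
    bracket_terms (c \<otimes> f) g p q (c \<otimes> r) X (c \<odot>\<^bsub>M\<^esub> Y) W V =
    bracket_terms f g (c \<otimes> p) (c \<otimes> q) r (c \<odot>\<^bsub>M\<^esub> X) Y W (c \<odot>\<^bsub>M\<^esub> V)"
  unfolding bracket_terms_def using R M by algebra

lemma bracket_terms_balanced_2: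
  "c \<in> carrier R \<Longrightarrow>
    bracket_terms f (c \<otimes> g) p (c \<otimes> q) r X Y W V =
    bracket_terms f g (c \<otimes> p) q (c \<otimes> r) (c \<odot>\<^bsub>M\<^esub> X) Y (c \<odot>\<^bsub>M\<^esub> W) V"
  unfolding bracket_terms_def using R M by algebra

end

end

text \<open>\<open>C\<close> consists of constants, \<open>Z\<close> generates the ring over them
  and \<open>U\<close> generates the module. Generation is stated as an induction principle, which
  avoids any normal form of elements. Symmetrization, invariance, the Leibniz identity and axioms
  (5) and (6) are assumed on generators only; the bracket formula is what carries them to
  \<open>E\<close>.\<close>

locale generated_bracket = module R E for R (structure) and E (structure) +
  fixes ip :: "'c \<Rightarrow> 'c \<Rightarrow> 'a" and d :: "'a \<Rightarrow> 'c" and br :: "'c \<Rightarrow> 'c \<Rightarrow> 'c"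
    and C Z :: "'a set" and U :: "'c set"
  assumes ip_closed [simp, intro]:
      "\<lbrakk>x \<in> carrier E; y \<in> carrier E\<rbrakk> \<Longrightarrow> ip x y \<in> carrier R"
    and ip_sym: "\<lbrakk>x \<in> carrier E; y \<in> carrier E\<rbrakk> \<Longrightarrow> ip x y = ip y x"
    and ip_add: "\<lbrakk>x \<in> carrier E; x' \<in> carrier E; y \<in> carrier E\<rbrakk>
        \<Longrightarrow> ip (x \<oplus>\<^bsub>E\<^esub> x') y = ip x y \<oplus> ip x' y"
    and ip_smult: "\<lbrakk>f \<in> carrier R; x \<in> carrier E; y \<in> carrier E\<rbrakk>
        \<Longrightarrow> ip (f \<odot>\<^bsub>E\<^esub> x) y = f \<otimes> ip x y"
    and d_closed [simp, intro]: "f \<in> carrier R \<Longrightarrow> d f \<in> carrier E"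
    and d_add: "\<lbrakk>f \<in> carrier R; g \<in> carrier R\<rbrakk> \<Longrightarrow> d (f \<oplus> g) = d f \<oplus>\<^bsub>E\<^esub> d g"
    and d_mult: "\<lbrakk>f \<in> carrier R; g \<in> carrier R\<rbrakk>
        \<Longrightarrow> d (f \<otimes> g) = f \<odot>\<^bsub>E\<^esub> d g \<oplus>\<^bsub>E\<^esub> g \<odot>\<^bsub>E\<^esub> d f"
    and d_const: "c \<in> C \<Longrightarrow> d c = \<zero>\<^bsub>E\<^esub>"
    and br_closed [simp, intro]:
      "\<lbrakk>x \<in> carrier E; y \<in> carrier E\<rbrakk> \<Longrightarrow> br x y \<in> carrier E"
    and br_add_left: "\<lbrakk>x \<in> carrier E; x' \<in> carrier E; y \<in> carrier E\<rbrakk>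
        \<Longrightarrow> br (x \<oplus>\<^bsub>E\<^esub> x') y = br x y \<oplus>\<^bsub>E\<^esub> br x' y"
    and br_add_right: "\<lbrakk>x \<in> carrier E; y \<in> carrier E; y' \<in> carrier E\<rbrakk>
        \<Longrightarrow> br x (y \<oplus>\<^bsub>E\<^esub> y') = br x y \<oplus>\<^bsub>E\<^esub> br x y'"
    and Z_closed: "Z \<subseteq> carrier R"
    and U_closed: "U \<subseteq> carrier E"
    and ring_generated: "\<lbrakk>f \<in> carrier R; \<And>c. c \<in> C \<Longrightarrow> Q c;
        \<And>f g. \<lbrakk>f \<in> carrier R; g \<in> carrier R; Q f; Q g\<rbrakk> \<Longrightarrow> Q (f \<oplus> g);
        \<And>z f. \<lbrakk>z \<in> Z; f \<in> carrier R; Q f\<rbrakk> \<Longrightarrow> Q (z \<otimes> f)\<rbrakk> \<Longrightarrow> Q f"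
    and module_generated: "\<lbrakk>x \<in> carrier E;
        \<And>f u. \<lbrakk>f \<in> carrier R; u \<in> U\<rbrakk> \<Longrightarrow> P (f \<odot>\<^bsub>E\<^esub> u);
        \<And>x y. \<lbrakk>x \<in> carrier E; y \<in> carrier E; P x; P y\<rbrakk> \<Longrightarrow> P (x \<oplus>\<^bsub>E\<^esub> y)\<rbrakk> \<Longrightarrow> P x"
    and br_generators: "\<lbrakk>f \<in> carrier R; g \<in> carrier R; u \<in> U; v \<in> U\<rbrakk>
        \<Longrightarrow> br (f \<odot>\<^bsub>E\<^esub> u) (g \<odot>\<^bsub>E\<^esub> v) =
          ((f \<otimes> g) \<odot>\<^bsub>E\<^esub> br u v \<oplus>\<^bsub>E\<^esub> (ip u v \<otimes> g) \<odot>\<^bsub>E\<^esub> d f \<oplus>\<^bsub>E\<^esub> (ip u (d g) \<otimes> f) \<odot>\<^bsub>E\<^esub> v)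
          \<ominus>\<^bsub>E\<^esub> (ip v (d f) \<otimes> g) \<odot>\<^bsub>E\<^esub> u"
    and symmetrized_generators: "\<lbrakk>u \<in> U; v \<in> U\<rbrakk> \<Longrightarrow> br u v \<oplus>\<^bsub>E\<^esub> br v u = d (ip u v)"
    and invariant_generators: "\<lbrakk>u \<in> U; v \<in> U; w \<in> U\<rbrakk>
        \<Longrightarrow> ip u (d (ip v w)) = ip (br u v) w \<oplus> ip v (br u w)"
    and leibniz_generators: "\<lbrakk>u \<in> U; v \<in> U; w \<in> U\<rbrakk>
        \<Longrightarrow> br u (br v w) = br (br u v) w \<oplus>\<^bsub>E\<^esub> br v (br u w)"
    and br_d_generators: "\<lbrakk>z \<in> Z; u \<in> U\<rbrakk> \<Longrightarrow> br (d z) u = \<zero>\<^bsub>E\<^esub>"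
    and ip_d_d_generators: "\<lbrakk>z \<in> Z; z' \<in> Z\<rbrakk> \<Longrightarrow> ip (d z) (d z') = \<zero>"
begin

section \<open>From generators to all elements\<close>

lemmas ring_induct [consumes 1, case_names const add mult] = ring_generated
lemmas module_induct [consumes 1, case_names smult add] = module_generated

lemma U_carrier [simp, intro]: "u \<in> U \<Longrightarrow> u \<in> carrier E"
  using U_closed by blast

lemma Z_carrier [simp, intro]: "z \<in> Z \<Longrightarrow> z \<in> carrier R"
  using Z_closed by blast

lemma ip_add_right:
  "\<lbrakk>x \<in> carrier E; y \<in> carrier E; y' \<in> carrier E\<rbrakk> \<Longrightarrow> ip x (y \<oplus>\<^bsub>E\<^esub> y') = ip x y \<oplus> ip x y'"
  using ip_add [of y y' x] ip_sym [of x] by simp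

lemma ip_smult_right:
  "\<lbrakk>f \<in> carrier R; x \<in> carrier E; y \<in> carrier E\<rbrakk> \<Longrightarrow> ip x (f \<odot>\<^bsub>E\<^esub> y) = f \<otimes> ip x y"
  using ip_smult [of f y x] ip_sym [of x] by simp

lemma ip_zero [simp]: "x \<in> carrier E \<Longrightarrow> ip \<zero>\<^bsub>E\<^esub> x = \<zero>"
  using ip_smult [of \<zero> "\<zero>\<^bsub>E\<^esub>" x] by simp

lemma ip_zero_right [simp]: "x \<in> carrier E \<Longrightarrow> ip x \<zero>\<^bsub>E\<^esub> = \<zero>"
  using ip_sym [of x] by simp

lemma ip_minus: "\<lbrakk>x \<in> carrier E; y \<in> carrier E\<rbrakk> \<Longrightarrow> ip (\<ominus>\<^bsub>E\<^esub> x) y = \<ominus> ip x y"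
  using ip_smult [of "\<ominus> \<one>" x y] by (simp add: smult_l_minus R.l_minus)

lemma ip_minus_right: "\<lbrakk>x \<in> carrier E; y \<in> carrier E\<rbrakk> \<Longrightarrow> ip x (\<ominus>\<^bsub>E\<^esub> y) = \<ominus> ip x y"
  using ip_minus [of y x] ip_sym [of x] by simp

lemmas ip_simps = ip_add ip_add_right ip_smult ip_smult_right ip_minus ip_minus_right

lemma br_zero_left [simp]: "x \<in> carrier E \<Longrightarrow> br \<zero>\<^bsub>E\<^esub> x = \<zero>\<^bsub>E\<^esub>"
  using br_add_left [of "\<zero>\<^bsub>E\<^esub>" "\<zero>\<^bsub>E\<^esub>" x] by (simp add: M.add.l_cancel_one')

text \<open>Replacing \<open>g\<close> by \<open>h \<otimes> g\<close> multiplies every term of the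
  bracket formula by \<open>h\<close>, except that \<open>ip u (d (h \<otimes> g))\<close> also
  yields \<open>g \<otimes> ip u (d h)\<close>. That extra summand is the anchor term on the
  right.\<close>

lemma br_module_smult_generators:
  assumes "u \<in> U" "v \<in> U" "f \<in> carrier R" "g \<in> carrier R" "h \<in> carrier R"
  shows "br (f \<odot>\<^bsub>E\<^esub> u) (h \<odot>\<^bsub>E\<^esub> (g \<odot>\<^bsub>E\<^esub> v)) =
    h \<odot>\<^bsub>E\<^esub> br (f \<odot>\<^bsub>E\<^esub> u) (g \<odot>\<^bsub>E\<^esub> v) \<oplus>\<^bsub>E\<^esub> ip (f \<odot>\<^bsub>E\<^esub> u) (d h) \<odot>\<^bsub>E\<^esub> (g \<odot>\<^bsub>E\<^esub> v)"
proof -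
  have cl: "u \<in> carrier E" "v \<in> carrier E" "br u v \<in> carrier E" "d f \<in> carrier E"
     "ip u v \<in> carrier R" "ip u (d g) \<in> carrier R" "ip v (d f) \<in> carrier R" "ip u (d h) \<in> carrier R"
    using assms by auto
  have 1: "br (f \<odot>\<^bsub>E\<^esub> u) (h \<odot>\<^bsub>E\<^esub> (g \<odot>\<^bsub>E\<^esub> v)) =
          ((f \<otimes> (h \<otimes> g)) \<odot>\<^bsub>E\<^esub> br u v \<oplus>\<^bsub>E\<^esub> (ip u v \<otimes> (h \<otimes> g)) \<odot>\<^bsub>E\<^esub> d f
           \<oplus>\<^bsub>E\<^esub> ((h \<otimes> ip u (d g) \<oplus> g \<otimes> ip u (d h)) \<otimes> f) \<odot>\<^bsub>E\<^esub> v)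
          \<ominus>\<^bsub>E\<^esub> (ip v (d f) \<otimes> (h \<otimes> g)) \<odot>\<^bsub>E\<^esub> u"
    using assms cl by (simp add: smult_assoc1 [symmetric] br_generators d_mult ip_simps)
  show ?thesis
    unfolding 1 ip_smult [OF assms(3) cl(1) d_closed [OF assms(5)]]
      br_generators [OF assms(3,4,1,2)]
    using assms(3-) cl by algebra
qed


theorem br_module_smult:
  assumes "x \<in> carrier E" "y \<in> carrier E" and h: "h \<in> carrier R"
  shows "br x (h \<odot>\<^bsub>E\<^esub> y) = h \<odot>\<^bsub>E\<^esub> br x y \<oplus>\<^bsub>E\<^esub> ip x (d h) \<odot>\<^bsub>E\<^esub> y"
  using assms(1)
proof (induction x rule: module_induct)
  case (smult f u)
  show ?case
    using assms(2)
  proof (induction y rule: module_induct)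
    case (smult g v)
    with \<open>f \<in> carrier R\<close> \<open>u \<in> U\<close> h show ?case
      by (simp add: br_module_smult_generators)
  next
    case (add y y')
    have cl: "br (f \<odot>\<^bsub>E\<^esub> u) y \<in> carrier E" "br (f \<odot>\<^bsub>E\<^esub> u) y' \<in> carrier E"
      "ip (f \<odot>\<^bsub>E\<^esub> u) (d h) \<in> carrier R"
      using smult add h by auto
    have "br (f \<odot>\<^bsub>E\<^esub> u) (h \<odot>\<^bsub>E\<^esub> (y \<oplus>\<^bsub>E\<^esub> y')) =
        br (f \<odot>\<^bsub>E\<^esub> u) (h \<odot>\<^bsub>E\<^esub> y) \<oplus>\<^bsub>E\<^esub> br (f \<odot>\<^bsub>E\<^esub> u) (h \<odot>\<^bsub>E\<^esub> y')"
      using smult add(1,2) h by (simp add: smult_r_distr br_add_right)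
    also have "\<dots> = h \<odot>\<^bsub>E\<^esub> (br (f \<odot>\<^bsub>E\<^esub> u) y \<oplus>\<^bsub>E\<^esub> br (f \<odot>\<^bsub>E\<^esub> u) y')
        \<oplus>\<^bsub>E\<^esub> ip (f \<odot>\<^bsub>E\<^esub> u) (d h) \<odot>\<^bsub>E\<^esub> (y \<oplus>\<^bsub>E\<^esub> y')"
      unfolding add(3,4) using cl add(1,2) h by algebra
    also have "br (f \<odot>\<^bsub>E\<^esub> u) y \<oplus>\<^bsub>E\<^esub> br (f \<odot>\<^bsub>E\<^esub> u) y' = br (f \<odot>\<^bsub>E\<^esub> u) (y \<oplus>\<^bsub>E\<^esub> y')"
      using smult add(1,2) by (simp add: br_add_right)
    finally show ?case .
  qed
next
  case (add x x')
  have cl: "br x y \<in> carrier E" "br x' y \<in> carrier E" "ip x (d h) \<in> carrier R" "ip x' (d h) \<in> carrier R"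
    using add h assms by auto
  have "br (x \<oplus>\<^bsub>E\<^esub> x') (h \<odot>\<^bsub>E\<^esub> y) = br x (h \<odot>\<^bsub>E\<^esub> y) \<oplus>\<^bsub>E\<^esub> br x' (h \<odot>\<^bsub>E\<^esub> y)"
    using assms(2) add(1,2) h by (simp add: br_add_left)
  also have "\<dots> = h \<odot>\<^bsub>E\<^esub> (br x y \<oplus>\<^bsub>E\<^esub> br x' y) \<oplus>\<^bsub>E\<^esub> (ip x (d h) \<oplus> ip x' (d h)) \<odot>\<^bsub>E\<^esub> y"
    unfolding add(3,4) using cl assms(2) h by algebra
  also have "\<dots> = h \<odot>\<^bsub>E\<^esub> br (x \<oplus>\<^bsub>E\<^esub> x') y \<oplus>\<^bsub>E\<^esub> ip (x \<oplus>\<^bsub>E\<^esub> x') (d h) \<odot>\<^bsub>E\<^esub> y"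
    using assms(2) add(1,2) h by (simp add: br_add_left ip_add)
  finally show ?case .
qed

text \<open>On generators the terms with \<open>ip u (d g)\<close> and \<open>ip v (d f)\<close>
  occur in the two brackets with opposite signs. What is left is the Leibniz rule for
  \<open>d (f \<otimes> g \<otimes> ip u v)\<close>. Both sides are additive in \<open>x\<close> and
  in \<open>y\<close>.\<close>

theorem br_symmetrized:
  assumes "x \<in> carrier E" "y \<in> carrier E"
  shows "br x y \<oplus>\<^bsub>E\<^esub> br y x = d (ip x y)"
  using assms(1)
proof (induction x rule: module_induct)
  case (smult f u)
  show ?case
    using assms(2)
  proof (induction y rule: module_induct)
    case (smult g v)
    note fg = \<open>f \<in> carrier R\<close> \<open>g \<in> carrier R\<close>
    have cl: "u \<in> carrier E" "v \<in> carrier E" "br u v \<in> carrier E" "br v u \<in> carrier E"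
      "d f \<in> carrier E" "d g \<in> carrier E" "ip u v \<in> carrier R"
      "ip u (d g) \<in> carrier R" "ip v (d f) \<in> carrier R"
      using smult \<open>u \<in> U\<close> fg by auto
    have vu: "ip v u = ip u v"
      using cl by (simp add: ip_sym)
    have "d (ip (f \<odot>\<^bsub>E\<^esub> u) (g \<odot>\<^bsub>E\<^esub> v)) = d ((f \<otimes> g) \<otimes> ip u v)"
      using cl fg by (simp add: ip_simps R.m_ac)
    also have "\<dots> = (f \<otimes> g) \<odot>\<^bsub>E\<^esub> (br u v \<oplus>\<^bsub>E\<^esub> br v u) \<oplus>\<^bsub>E\<^esub> ip u v \<odot>\<^bsub>E\<^esub> (f \<odot>\<^bsub>E\<^esub> d g \<oplus>\<^bsub>E\<^esub> g \<odot>\<^bsub>E\<^esub> d f)"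
      using cl fg smult \<open>u \<in> U\<close> by (simp add: d_mult symmetrized_generators)
    finally have *: "d (ip (f \<odot>\<^bsub>E\<^esub> u) (g \<odot>\<^bsub>E\<^esub> v)) = \<dots>" .
    show ?case
      unfolding * br_generators [OF fg \<open>u \<in> U\<close> smult(2)] br_generators [OF fg(2,1) smult(2) \<open>u \<in> U\<close>] vu
      using cl fg by algebra
  next
    case (add y y')
    have cl: "f \<odot>\<^bsub>E\<^esub> u \<in> carrier E"
      using smult by auto
    have "br (f \<odot>\<^bsub>E\<^esub> u) (y \<oplus>\<^bsub>E\<^esub> y') \<oplus>\<^bsub>E\<^esub> br (y \<oplus>\<^bsub>E\<^esub> y') (f \<odot>\<^bsub>E\<^esub> u) =
      (br (f \<odot>\<^bsub>E\<^esub> u) y \<oplus>\<^bsub>E\<^esub> br y (f \<odot>\<^bsub>E\<^esub> u)) \<oplus>\<^bsub>E\<^esub> (br (f \<odot>\<^bsub>E\<^esub> u) y' \<oplus>\<^bsub>E\<^esub> br y' (f \<odot>\<^bsub>E\<^esub> u))"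
      using cl add(1,2) by (simp add: br_add_left br_add_right M.a_ac)
    then show ?case
      using cl add by (simp add: ip_add_right d_add)
  qed
next
  case (add x x')
  have "br (x \<oplus>\<^bsub>E\<^esub> x') y \<oplus>\<^bsub>E\<^esub> br y (x \<oplus>\<^bsub>E\<^esub> x') =
      (br x y \<oplus>\<^bsub>E\<^esub> br y x) \<oplus>\<^bsub>E\<^esub> (br x' y \<oplus>\<^bsub>E\<^esub> br y x')"
    using assms(2) add(1,2) by (simp add: br_add_left br_add_right M.a_ac)
  then show ?case
    using assms(2) add by (simp add: ip_add d_add)
qed

lemma br_swap:
  assumes "x \<in> carrier E" "y \<in> carrier E"
  shows "br y x = d (ip x y) \<ominus>\<^bsub>E\<^esub> br x y"
proof -
  have "br x y \<in> carrier E" "br y x \<in> carrier E"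
    using assms by auto
  then show ?thesis
    unfolding br_symmetrized [OF assms, symmetric] by algebra
qed

text \<open>This is the right Leibniz rule carried through \<open>br_swap\<close>: the term with
  \<open>d f\<close> comes from differentiating \<open>f \<otimes> ip x y\<close>, the negative one
  from the anchor term of \<open>br y (f \<odot> x)\<close>.\<close>

lemma br_smult_left:
  assumes "x \<in> carrier E" "y \<in> carrier E" and f: "f \<in> carrier R"
  shows "br (f \<odot>\<^bsub>E\<^esub> x) y =
    (f \<odot>\<^bsub>E\<^esub> br x y \<oplus>\<^bsub>E\<^esub> ip x y \<odot>\<^bsub>E\<^esub> d f) \<ominus>\<^bsub>E\<^esub> ip y (d f) \<odot>\<^bsub>E\<^esub> x"
proof -
  have cl: "br x y \<in> carrier E" "br y x \<in> carrier E" "d f \<in> carrier E" "d (ip x y) \<in> carrier E"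
    "ip x y \<in> carrier R" "ip y (d f) \<in> carrier R"
    using assms by auto
  have "br (f \<odot>\<^bsub>E\<^esub> x) y = d (ip y (f \<odot>\<^bsub>E\<^esub> x)) \<ominus>\<^bsub>E\<^esub> br y (f \<odot>\<^bsub>E\<^esub> x)"
    using assms by (intro br_swap) auto
  also have "\<dots> = (f \<odot>\<^bsub>E\<^esub> d (ip x y) \<oplus>\<^bsub>E\<^esub> ip x y \<odot>\<^bsub>E\<^esub> d f) \<ominus>\<^bsub>E\<^esub> (f \<odot>\<^bsub>E\<^esub> br y x \<oplus>\<^bsub>E\<^esub> ip y (d f) \<odot>\<^bsub>E\<^esub> x)"
    using assms by (simp add: br_module_smult ip_smult_right ip_sym [of y x] d_mult)
  also have "br y x = d (ip x y) \<ominus>\<^bsub>E\<^esub> br x y"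
    using assms by (intro br_swap) auto
  finally show ?thesis
    using cl assms by algebra
qed

text \<open>As a function of \<open>f\<close>, and likewise of \<open>g\<close>, the expression is a
  derivation, so its vanishing on constants and on \<open>Z\<close> propagates. The second argument
  is extended while the first is still a generator.\<close>

theorem ip_d_d:
  assumes "f \<in> carrier R" "g \<in> carrier R"
  shows "ip (d f) (d g) = \<zero>"
  using assms(1)
proof (induction f rule: ring_induct)
  case (const c)
  then show ?case using assms(2) by (simp add: d_const)
next
  case (add f f')
  then show ?case using assms(2) by (simp add: d_add ip_simps)
next
  case (mult z f)
  have "ip (d z) (d g) = \<zero>"
    using assms(2)
  proof (induction g rule: ring_induct)
    case (const c)
    then show ?case using mult by (simp add: d_const)
  next
    case (add f f')
    then show ?case using mult by (simp add: d_add ip_simps)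
  next
    case (mult z' f)
    then show ?case using \<open>z \<in> Z\<close> by (simp add: d_mult ip_simps ip_d_d_generators)
  qed
  then show ?case using mult assms(2) by (simp add: d_mult ip_simps)
qed

theorem br_d_left:
  assumes "f \<in> carrier R" "x \<in> carrier E"
  shows "br (d f) x = \<zero>\<^bsub>E\<^esub>"
  using assms(1)
proof (induction f rule: ring_induct)
  case (const c)
  then show ?case using assms(2) by (simp add: d_const)
next
  case (add f f')
  then show ?case using assms(2) by (simp add: d_add br_add_left)
next
  case (mult z f)
  \<comment> \<open>The right Leibniz rule for \<open>br (d z) (g u)\<close> has the extra
    coefficient \<open>ip (d z) (d g)\<close>, which is zero by isotropy. So vanishing on
    \<open>U\<close> suffices for a generator \<open>z\<close>.\<close>
  have z: "br (d z) x = \<zero>\<^bsub>E\<^esub>"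
    using assms(2)
  proof (induction x rule: module_induct)
    case (smult g u)
    then show ?case using mult by (simp add: br_module_smult br_d_generators ip_d_d)
  next
    case (add x x')
    then show ?case using mult by (simp add: br_add_right)
  qed
  have cl: "d z \<in> carrier E" "d f \<in> carrier E" "z \<in> carrier R" "f \<in> carrier R"
    "ip (d z) x \<in> carrier R" "ip (d f) x \<in> carrier R"
    using mult assms by auto
  have "br (d (z \<otimes> f)) x = br (z \<odot>\<^bsub>E\<^esub> d f) x \<oplus>\<^bsub>E\<^esub> br (f \<odot>\<^bsub>E\<^esub> d z) x"
    using cl assms(2) by (simp add: d_mult br_add_left)
  \<comment> \<open>Both left Leibniz rules lose their bracket term by the vanishing already known.
    Their remaining terms cancel crosswise, \<open>d z\<close> and \<open>d f\<close> each appearing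
    once with either sign.\<close>
  also have "\<dots> = (z \<odot>\<^bsub>E\<^esub> \<zero>\<^bsub>E\<^esub> \<oplus>\<^bsub>E\<^esub> ip (d f) x \<odot>\<^bsub>E\<^esub> d z) \<ominus>\<^bsub>E\<^esub> ip (d z) x \<odot>\<^bsub>E\<^esub> d f \<oplus>\<^bsub>E\<^esub>
     ((f \<odot>\<^bsub>E\<^esub> \<zero>\<^bsub>E\<^esub> \<oplus>\<^bsub>E\<^esub> ip (d z) x \<odot>\<^bsub>E\<^esub> d f) \<ominus>\<^bsub>E\<^esub> ip (d f) x \<odot>\<^bsub>E\<^esub> d z)"
    using cl assms(2) mult z by (simp add: br_smult_left ip_sym [of x])
  also have "\<dots> = \<zero>\<^bsub>E\<^esub>"
    using cl by algebra
  finally show ?case .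
qed

lemma br_d_right:
  assumes "x \<in> carrier E" "f \<in> carrier R"
  shows "br x (d f) = d (ip x (d f))"
  using br_symmetrized [of "d f" x] assms by (simp add: br_d_left ip_sym [of x])

theorem ip_invariant:
  assumes "x \<in> carrier E" "y \<in> carrier E" "z \<in> carrier E"
  shows "ip x (d (ip y z)) = ip (br x y) z \<oplus> ip y (br x z)"
proof -
  \<comment> \<open>The last argument is freed before the middle one and the first one. In the last
    and in the middle argument a factor \<open>f\<close> adds the same term to both sides,
    \<open>ip u (d f)\<close> times the old inner product.\<close>
  have gen: "ip u (d (ip v z)) = ip (br u v) z \<oplus> ip v (br u z)"
    if "u \<in> U" "v \<in> U" "z \<in> carrier E" for u v z
    using that(3)
  proof (induction z rule: module_induct)
    case (smult f w)
    have cl: "ip u (d f) \<in> carrier R" "ip v w \<in> carrier R" "ip (br u v) w \<in> carrier R"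
      "ip v (br u w) \<in> carrier R"
      using smult that by auto
    have "ip u (d (ip v (f \<odot>\<^bsub>E\<^esub> w))) = f \<otimes> ip u (d (ip v w)) \<oplus> ip v w \<otimes> ip u (d f)"
      using smult that by (simp add: ip_simps d_mult)
    also have "\<dots> = f \<otimes> ip (br u v) w \<oplus> (f \<otimes> ip v (br u w) \<oplus> ip u (d f) \<otimes> ip v w)"
      using smult that cl by (simp add: invariant_generators R.r_distr R.m_comm R.a_assoc)
    also have "\<dots> = ip (br u v) (f \<odot>\<^bsub>E\<^esub> w) \<oplus> ip v (br u (f \<odot>\<^bsub>E\<^esub> w))"
      using smult that by (simp add: br_module_smult ip_simps)
    finally show ?case .
  next
    case (add z z')
    then show ?case
      using that(1,2) by (simp add: ip_simps d_add br_add_right R.a_ac)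
  qed
  have middle: "ip u (d (ip y z)) = ip (br u y) z \<oplus> ip y (br u z)"
    if "u \<in> U" "y \<in> carrier E" "z \<in> carrier E" for u y z
    using that(2)
  proof (induction y rule: module_induct)
    case (smult f v)
    have cl: "ip u (d f) \<in> carrier R" "ip v z \<in> carrier R" "ip (br u v) z \<in> carrier R"
      "ip v (br u z) \<in> carrier R"
      using smult that by auto
    have "ip u (d (ip (f \<odot>\<^bsub>E\<^esub> v) z)) = f \<otimes> ip u (d (ip v z)) \<oplus> ip v z \<otimes> ip u (d f)"
      using smult that by (simp add: ip_simps d_mult)
    also have "\<dots> = (f \<otimes> ip (br u v) z \<oplus> ip u (d f) \<otimes> ip v z) \<oplus> f \<otimes> ip v (br u z)"
      unfolding gen [OF that(1) smult(2) that(3)] using smult cl by algebra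
    also have "\<dots> = ip (br u (f \<odot>\<^bsub>E\<^esub> v)) z \<oplus> ip (f \<odot>\<^bsub>E\<^esub> v) (br u z)"
      using smult that by (simp add: br_module_smult ip_simps)
    finally show ?case .
  next
    case (add y y')
    then show ?case
      using that(1,3) by (simp add: ip_simps d_add br_add_right R.a_ac)
  qed
  show ?thesis
    using assms(1)
  proof (induction x rule: module_induct)
    case (smult f u)
    have cl: "ip (d f) z \<in> carrier R" "ip (d f) y \<in> carrier R" "ip u z \<in> carrier R" "ip u y \<in> carrier R"
       "ip (br u y) z \<in> carrier R" "ip y (br u z) \<in> carrier R"
      using smult assms by auto
    \<comment> \<open>The corrections of the left Leibniz rule in the two summands are negatives of
      each other, so no derivative of \<open>f\<close> survives and the whole expression is linear
      in the first argument.\<close>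
    have "ip (br (f \<odot>\<^bsub>E\<^esub> u) y) z \<oplus> ip y (br (f \<odot>\<^bsub>E\<^esub> u) z) =
       ((f \<otimes> ip (br u y) z \<oplus> ip u y \<otimes> ip (d f) z) \<oplus> \<ominus> (ip (d f) y \<otimes> ip u z)) \<oplus>
       ((f \<otimes> ip y (br u z) \<oplus> ip u z \<otimes> ip (d f) y) \<oplus> \<ominus> (ip (d f) z \<otimes> ip u y))"
      using smult assms by (simp add: br_smult_left M.minus_eq ip_simps ip_sym [of y] ip_sym [of z])
    also have "\<dots> = f \<otimes> ip (br u y) z \<oplus> f \<otimes> ip y (br u z)"
      using smult cl by algebra
    also have "\<dots> = ip (f \<odot>\<^bsub>E\<^esub> u) (d (ip y z))"
      using smult assms cl by (simp add: ip_simps middle R.r_distr)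
    finally show ?case by simp
  next
    case (add x x')
    then show ?case
      using assms(2,3) by (simp add: ip_simps br_add_left R.a_ac)
  qed
qed

text \<open>Invariance with \<open>d f\<close> as third argument, where \<open>br x (d f)\<close> is
  again in the image of \<open>d\<close>. With \<open>\<rho>(x) f = ip x (d f)\<close> it says
  \<open>\<rho>(x \<circ> y) = [\<rho>(x), \<rho>(y)]\<close>.\<close>

lemma anchor_br:
  assumes "x \<in> carrier E" "y \<in> carrier E" "f \<in> carrier R"
  shows "ip x (d (ip y (d f))) = ip (br x y) (d f) \<oplus> ip y (d (ip x (d f)))"
  using ip_invariant [of x y "d f"] assms by (simp add: br_d_right)

section \<open>The Jacobiator\<close>

definition jacobiator :: "'c \<Rightarrow> 'c \<Rightarrow> 'c \<Rightarrow> 'c" where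
  "jacobiator x y z = br x (br y z) \<ominus>\<^bsub>E\<^esub> (br (br x y) z \<oplus>\<^bsub>E\<^esub> br y (br x z))"

lemma jacobiator_add:
  assumes "x \<in> carrier E" "y \<in> carrier E" "z \<in> carrier E" "z' \<in> carrier E"
  shows "jacobiator x y (z \<oplus>\<^bsub>E\<^esub> z') = jacobiator x y z \<oplus>\<^bsub>E\<^esub> jacobiator x y z'"
  using assms by (simp add: jacobiator_def br_add_right M.minus_eq M.minus_add M.a_ac)

text \<open>The mixed terms \<open>?xf\<close> times \<open>br y z\<close> and \<open>?yf\<close>
  times \<open>br x z\<close> appear in both iterated brackets and cancel. The coefficient of
  \<open>z\<close> that remains is zero by \<open>anchor_br\<close>.\<close>

lemma jacobiator_smult:
  assumes "x \<in> carrier E" "y \<in> carrier E" "z \<in> carrier E" and f: "f \<in> carrier R"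
  shows "jacobiator x y (f \<odot>\<^bsub>E\<^esub> z) = f \<odot>\<^bsub>E\<^esub> jacobiator x y z"
proof -
  let ?xf = "ip x (d f)" and ?yf = "ip y (d f)"
  have cl: "ip x (d f) \<in> carrier R" "ip y (d f) \<in> carrier R" "br x z \<in> carrier E" "br y z \<in> carrier E"
    "br x y \<in> carrier E" "br x (br y z) \<in> carrier E" "br (br x y) z \<in> carrier E"
    "br y (br x z) \<in> carrier E" "ip (br x y) (d f) \<in> carrier R" "ip y (d (ip x (d f))) \<in> carrier R"
    using assms by auto
  have 1: "br x (br y (f \<odot>\<^bsub>E\<^esub> z)) =
      (f \<odot>\<^bsub>E\<^esub> br x (br y z) \<oplus>\<^bsub>E\<^esub> ?xf \<odot>\<^bsub>E\<^esub> br y z) \<oplus>\<^bsub>E\<^esub> (?yf \<odot>\<^bsub>E\<^esub> br x z \<oplus>\<^bsub>E\<^esub> ip x (d ?yf) \<odot>\<^bsub>E\<^esub> z)"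
    using assms by (simp add: br_module_smult br_add_right)
  have 2: "br y (br x (f \<odot>\<^bsub>E\<^esub> z)) =
      (f \<odot>\<^bsub>E\<^esub> br y (br x z) \<oplus>\<^bsub>E\<^esub> ?yf \<odot>\<^bsub>E\<^esub> br x z) \<oplus>\<^bsub>E\<^esub> (?xf \<odot>\<^bsub>E\<^esub> br y z \<oplus>\<^bsub>E\<^esub> ip y (d ?xf) \<odot>\<^bsub>E\<^esub> z)"
    using assms by (simp add: br_module_smult br_add_right)
  have 3: "br (br x y) (f \<odot>\<^bsub>E\<^esub> z) = f \<odot>\<^bsub>E\<^esub> br (br x y) z \<oplus>\<^bsub>E\<^esub> ip (br x y) (d f) \<odot>\<^bsub>E\<^esub> z"
    using assms by (simp add: br_module_smult)
  show ?thesis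
    unfolding jacobiator_def 1 2 3 anchor_br [OF assms(1,2) f]
    using cl assms(3) f by algebra
qed

text \<open>The symmetric part of \<open>br x y\<close> is \<open>d (ip x y)\<close>, which acts as
  zero from the left.\<close>

lemma jacobiator_swap_left:
  assumes "x \<in> carrier E" "y \<in> carrier E" "z \<in> carrier E"
  shows "jacobiator y x z = \<ominus>\<^bsub>E\<^esub> jacobiator x y z"
proof -
  have cl: "br x (br y z) \<in> carrier E" "br y (br x z) \<in> carrier E" "br (br x y) z \<in> carrier E"
    "br (br y x) z \<in> carrier E"
    using assms by auto
  have "br (br x y) z \<oplus>\<^bsub>E\<^esub> br (br y x) z = br (d (ip x y)) z"
    using assms by (simp flip: br_add_left br_symmetrized)
  also have "\<dots> = \<zero>\<^bsub>E\<^esub>"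
    using assms by (simp add: br_d_left)
  finally have "br (br y x) z = \<ominus>\<^bsub>E\<^esub> br (br x y) z"
    using cl by (metis M.a_comm M.minus_equality)
  then show ?thesis
    unfolding jacobiator_def using cl by algebra
qed

text \<open>The symmetric part of the inner bracket gives
  \<open>br x (d (ip y z)) = d (ip x (d (ip y z)))\<close>. Invariance splits this into two values
  of \<open>d\<close>, and symmetrization turns each back into a sum of two brackets; these are the
  four remaining terms of the two Jacobiators.\<close>

lemma jacobiator_swap_right:
  assumes "x \<in> carrier E" "y \<in> carrier E" "z \<in> carrier E"
  shows "jacobiator x z y = \<ominus>\<^bsub>E\<^esub> jacobiator x y z"
proof -
  let ?a = "br x (br y z)" and ?b = "br x (br z y)" and ?c = "br (br x y) z"
    and ?e = "br (br x z) y" and ?p = "br y (br x z)" and ?q = "br z (br x y)"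
  have cl: "?a \<in> carrier E" "?b \<in> carrier E" "?c \<in> carrier E" "?e \<in> carrier E"
    "?p \<in> carrier E" "?q \<in> carrier E"
    using assms by auto
  have "?a \<oplus>\<^bsub>E\<^esub> ?b = br x (d (ip y z))"
    using assms by (simp flip: br_add_right br_symmetrized)
  also have "\<dots> = d (ip (br x y) z) \<oplus>\<^bsub>E\<^esub> d (ip y (br x z))"
    using assms by (simp add: br_d_right ip_invariant d_add)
  also have "\<dots> = (?c \<oplus>\<^bsub>E\<^esub> ?q) \<oplus>\<^bsub>E\<^esub> (?p \<oplus>\<^bsub>E\<^esub> ?e)"
    using assms by (simp add: br_symmetrized)
  finally have ab: "?a \<oplus>\<^bsub>E\<^esub> ?b = \<dots>" .
  have b: "?b = ((?c \<oplus>\<^bsub>E\<^esub> ?q) \<oplus>\<^bsub>E\<^esub> (?p \<oplus>\<^bsub>E\<^esub> ?e)) \<ominus>\<^bsub>E\<^esub> ?a"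
    unfolding ab [symmetric] using cl by algebra
  show ?thesis
    unfolding jacobiator_def b using cl by algebra
qed

lemma jacobiator_zero_induct:
  assumes "x \<in> carrier E" "y \<in> carrier E" "z \<in> carrier E"
    and "\<And>w. w \<in> U \<Longrightarrow> jacobiator x y w = \<zero>\<^bsub>E\<^esub>"
  shows "jacobiator x y z = \<zero>\<^bsub>E\<^esub>"
  using assms(3)
  by (induction z rule: module_induct) (use assms(1,2,4) in \<open>auto simp: jacobiator_add jacobiator_smult\<close>)

text \<open>
  The Jacobiator is \<open>R\<close>-linear in its last argument and alternating, hence it is determined by its
  values on generators.
\<close>

lemma jacobiator_eq_zero:
  assumes "x \<in> carrier E" "y \<in> carrier E" "z \<in> carrier E"
  shows "jacobiator x y z = \<zero>\<^bsub>E\<^esub>"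
proof -
  have "jacobiator u v w = \<zero>\<^bsub>E\<^esub>" if "u \<in> U" "v \<in> U" "w \<in> U" for u v w
    unfolding jacobiator_def leibniz_generators [OF that] using that by (simp add: M.minus_eq M.r_neg)
  then have 1: "jacobiator u v z = \<zero>\<^bsub>E\<^esub>" if "u \<in> U" "v \<in> U" "z \<in> carrier E" for u v z
    using that by (auto intro: jacobiator_zero_induct [OF U_carrier U_carrier])
  have 2: "jacobiator u y z = \<zero>\<^bsub>E\<^esub>" if "u \<in> U" "y \<in> carrier E" "z \<in> carrier E" for u y z
  proof (rule jacobiator_zero_induct)
    fix w assume "w \<in> U"
    have "jacobiator u y w = \<ominus>\<^bsub>E\<^esub> jacobiator u w y"
      using that \<open>w \<in> U\<close> by (intro jacobiator_swap_right) auto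
    then show "jacobiator u y w = \<zero>\<^bsub>E\<^esub>"
      using that \<open>w \<in> U\<close> by (simp add: 1)
  qed (use that in auto)
  have "jacobiator x y w = \<zero>\<^bsub>E\<^esub>" if "w \<in> U" for w
  proof -
    have "jacobiator x y w = \<ominus>\<^bsub>E\<^esub> jacobiator x w y"
      using that assms by (intro jacobiator_swap_right) auto
    also have "jacobiator x w y = \<ominus>\<^bsub>E\<^esub> jacobiator w x y"
      using that assms by (intro jacobiator_swap_left) auto
    finally show ?thesis
      using that assms by (simp add: 2)
  qed
  then show ?thesis
    by (rule jacobiator_zero_induct [OF assms])
qed

theorem br_leibniz:
  assumes "x \<in> carrier E" "y \<in> carrier E" "z \<in> carrier E"
  shows "br x (br y z) = br (br x y) z \<oplus>\<^bsub>E\<^esub> br y (br x z)"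
proof -
  have cl: "br x (br y z) \<in> carrier E" "br (br x y) z \<in> carrier E" "br y (br x z) \<in> carrier E"
    using assms by auto
  have "br x (br y z) = jacobiator x y z \<oplus>\<^bsub>E\<^esub> (br (br x y) z \<oplus>\<^bsub>E\<^esub> br y (br x z))"
    unfolding jacobiator_def using cl by algebra
  then show ?thesis
    using cl by (simp add: jacobiator_eq_zero [OF assms])
qed

end

text \<open>Linearity over the scalars is a special case of the two Leibniz rules: a scalar acts as
  the ring element \<open>c \<odot> \<one>\<close>, which lies in \<open>C\<close> and is therefore
  killed by \<open>d\<close>.\<close>

lemma generated_bracket_courant_dorfman:
  fixes K :: "('k, 'm) ring_scheme" and R :: "('k, 'r, 'p) module_scheme"
  assumes gen: "generated_bracket R E ip d br C Z U" and alg: "algebra K R" and der: "derivation K R E d"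
    and const: "\<And>c. c \<in> carrier K \<Longrightarrow> c \<odot>\<^bsub>R\<^esub> \<one>\<^bsub>R\<^esub> \<in> C"
  shows "courant_dorfman_algebra K R E ip d br"
proof -
  interpret K: algebra K R by fact
  interpret generated_bracket R E ip d br C Z U by fact
  have c: "c \<odot>\<^bsub>R\<^esub> \<one>\<^bsub>R\<^esub> \<in> carrier R" if "c \<in> carrier K" for c
    using that by simp
  show ?thesis
  proof (intro courant_dorfman_algebra.intro courant_dorfman_algebra_axioms.intro)
    show "br (res_smult R E c x) y = res_smult R E c (br x y)"
      if "c \<in> carrier K" "x \<in> carrier E" "y \<in> carrier E" for c x y
      unfolding res_smult_def using that c [OF that(1)]
      by (simp add: br_smult_left d_const const M.minus_eq)
    show "br x (res_smult R E c y) = res_smult R E c (br x y)"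
      if "c \<in> carrier K" "x \<in> carrier E" "y \<in> carrier E" for c x y
      unfolding res_smult_def using that c [OF that(1)]
      by (simp add: br_module_smult d_const const)
  qed (use alg der module_axioms in \<open>auto simp: ip_add ip_smult br_add_left br_add_right
      br_module_smult ip_invariant br_symmetrized br_d_left ip_d_d intro: ip_sym br_leibniz\<close>)
qed

lemma (in abelian_group) add_minus_minus_eq_zero:
  assumes "x \<in> carrier G" "y \<in> carrier G"
  shows "x \<oplus> y \<ominus> x \<ominus> y = \<zero>"
proof -
  have "x \<oplus> y \<ominus> x = y"
    using assms by (simp add: minus_eq a_comm [of x] a_assoc r_neg)
  then show ?thesis
    using assms by (simp add: minus_eq r_neg)
qed

lemma (in abelian_group) eq_of_minus_eq_zero:
  assumes "x \<in> carrier G" "y \<in> carrier G" "x \<ominus> y = \<zero>"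
  shows "x = y"
  using assms by (metis a_minus_def a_inv_closed minus_equality minus_minus)

lemma (in abelian_group) minus_self [simp]: "x \<in> carrier G \<Longrightarrow> x \<ominus> x = \<zero>"
  by (simp add: minus_eq r_neg)


section \<open>The symmetric algebra and its derivations\<close>

text \<open>The monomial case is restricted to monomials of the given \<open>p\<close>, so that a
  bound on the variables of \<open>p\<close> is available there, while the coefficient is
  free.\<close>

lemma poly_mapping_monomial_induct [case_names monomial add zero]:
  fixes p :: "'a \<Rightarrow>\<^sub>0 'b::comm_monoid_add"
  assumes "\<And>m c. m \<in> Poly_Mapping.keys p \<Longrightarrow> Q (Poly_Mapping.single m c)"
    and "\<And>p q. \<lbrakk>Q p; Q q\<rbrakk> \<Longrightarrow> Q (p + q)" and "Q 0"
  shows "Q p"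
proof -
  have "Q (\<Sum>m\<in>A. Poly_Mapping.single m (Poly_Mapping.lookup p m))" if "A \<subseteq> Poly_Mapping.keys p" for A
    using finite_subset [OF that finite_keys] that by induction (auto simp: assms)
  moreover have "(\<Sum>m\<in>Poly_Mapping.keys p. Poly_Mapping.single m (Poly_Mapping.lookup p m)) = p"
    by (rule poly_mapping_eqI)
      (auto simp: lookup_sum lookup_single when_def in_keys_iff sum.delta)
  ultimately show ?thesis
    by (metis order_refl)
qed

text \<open>The formal partial derivative, read off from coefficients: \<open>m\<close> arises from
  the monomial \<open>add_mset v m\<close>, in which \<open>v\<close> has exponent
  \<open>Suc (count m v)\<close>. In this form additivity is immediate.\<close>

definition pdiff :: "'v \<Rightarrow> ('v multiset \<Rightarrow>\<^sub>0 'k::comm_ring_1) \<Rightarrow> ('v multiset \<Rightarrow>\<^sub>0 'k)" where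
  "pdiff v p = Abs_poly_mapping (\<lambda>m. of_nat (Suc (count m v)) * Poly_Mapping.lookup p (add_mset v m))"

lemma lookup_pdiff:
  "Poly_Mapping.lookup (pdiff v p) m = of_nat (Suc (count m v)) * Poly_Mapping.lookup p (add_mset v m)"
proof -
  have "finite (add_mset v -` Poly_Mapping.keys p)"
    by (rule finite_vimageI) (auto simp: inj_def)
  then have "finite {m. of_nat (Suc (count m v)) * Poly_Mapping.lookup p (add_mset v m) \<noteq> 0}"
    by (rule rev_finite_subset) (auto simp: in_keys_iff)
  then show ?thesis
    by (simp add: pdiff_def del: of_nat_Suc)
qed

lemma keys_pdiff: "m \<in> Poly_Mapping.keys (pdiff v p) \<Longrightarrow> add_mset v m \<in> Poly_Mapping.keys p"
  by (auto simp: in_keys_iff lookup_pdiff)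

lemma pdiff_add: "pdiff v (p + q) = pdiff v p + pdiff v q"
  by (rule poly_mapping_eqI) (simp add: lookup_pdiff lookup_add distrib_left del: of_nat_Suc)

lemma pdiff_zero [simp]: "pdiff v 0 = 0"
  by (rule poly_mapping_eqI) (simp add: lookup_pdiff)

text \<open>If \<open>v\<close> does not occur in \<open>m\<close>, then \<open>m - {#v#}\<close> is
  just \<open>m\<close>, but the factor \<open>count m v\<close> is zero.\<close>

lemma pdiff_single:
  "pdiff v (Poly_Mapping.single m c) = Poly_Mapping.single (m - {#v#}) (of_nat (count m v) * c)"
proof (cases "v \<in># m")
  case True
  then obtain n where "m = add_mset v n"
    by (auto dest: multi_member_split)
  then show ?thesis
    by (intro poly_mapping_eqI) (auto simp: lookup_pdiff lookup_single when_def simp del: of_nat_Suc)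
next
  case False
  then show ?thesis
    by (intro poly_mapping_eqI)
      (auto simp: lookup_pdiff lookup_single when_def not_in_iff simp del: of_nat_Suc)
qed

lemma pdiff_mult: "pdiff v (p * q) = p * pdiff v q + q * pdiff v p"
proof (induction p rule: poly_mapping_monomial_induct)
  case (monomial m c)
  show ?case
  proof (induction q rule: poly_mapping_monomial_induct)
    case (monomial n e)
    \<comment> \<open>The two multisets can differ when \<open>v\<close> occurs in \<open>m\<close>
      but not in \<open>n\<close>; then both coefficients are zero. The same holds for the next
      equation with \<open>m\<close> and \<open>n\<close> exchanged.\<close>
    have 1: "Poly_Mapping.single (m + n - {#v#}) (of_nat (count n v) * (c * e)) =
      Poly_Mapping.single (m + (n - {#v#})) (c * (of_nat (count n v) * e))"
      by (cases "v \<in># n") (auto simp: not_in_iff mult_ac)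
    have 2: "Poly_Mapping.single (m + n - {#v#}) (of_nat (count m v) * (c * e)) =
      Poly_Mapping.single (n + (m - {#v#})) (e * (of_nat (count m v) * c))"
      by (cases "v \<in># m") (auto simp: not_in_iff mult_ac add_ac)
    show ?case
      by (simp add: mult_single pdiff_single distrib_right single_add 1 2 add_ac)
  next
    case (add p q)
    then show ?case by (simp add: pdiff_add algebra_simps)
  qed simp
next
  case (add p q)
  then show ?case by (simp add: pdiff_add algebra_simps)
qed simp

definition vars :: "('v multiset \<Rightarrow>\<^sub>0 'k::zero) \<Rightarrow> 'v set" where
  "vars p = (\<Union>m\<in>Poly_Mapping.keys p. set_mset m)"

lemma finite_vars [simp]: "finite (vars p)"
  by (simp add: vars_def)

lemma pdiff_eq_zero: "v \<notin> vars p \<Longrightarrow> pdiff v p = 0"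
  using keys_pdiff [of _ v p] by (fastforce simp: vars_def simp flip: keys_eq_empty)

section \<open>The scalars and the polynomial algebra on a set of variables\<close>

lemma cring_scalars: "cring (scalars :: 'k::real_normed_field ring)"
proof (intro cringI abelian_groupI comm_monoidI)
  show "\<exists>y\<in>carrier scalars. y \<oplus>\<^bsub>scalars\<^esub> x = \<zero>\<^bsub>scalars\<^esub>" for x :: 'k
    by (rule bexI [of _ "- x"]) (auto simp: scalars_def)
qed (auto simp: scalars_def algebra_simps)

lemma scalars_simps [simp]:
  "carrier (scalars :: 'k::real_normed_field ring) = UNIV"
  "c \<otimes>\<^bsub>scalars\<^esub> e = c * e" "c \<oplus>\<^bsub>scalars\<^esub> e = c + e" "\<one>\<^bsub>scalars\<^esub> = 1" "\<zero>\<^bsub>scalars\<^esub> = 0"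
  for c e :: "'k::real_normed_field"
  by (simp_all add: scalars_def)

lemma free_comm_algebra_simps [simp]:
  "p \<otimes>\<^bsub>free_comm_algebra X\<^esub> q = p * q" "p \<oplus>\<^bsub>free_comm_algebra X\<^esub> q = p + q"
  "\<one>\<^bsub>free_comm_algebra X\<^esub> = 1" "\<zero>\<^bsub>free_comm_algebra X\<^esub> = 0"
  "c \<odot>\<^bsub>free_comm_algebra X\<^esub> p = Poly_Mapping.single {#} c * p"
  by (simp_all add: free_comm_algebra_def)

lemma carrier_free_comm_algebra: "p \<in> carrier (free_comm_algebra X) \<longleftrightarrow> vars p \<subseteq> X"
  by (auto simp: free_comm_algebra_def vars_def)

lemma vars_add: "vars (p + q) \<subseteq> vars p \<union> vars q"
  using keys_add [of p q] by (auto simp: vars_def)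

lemma vars_mult: "vars (p * q) \<subseteq> vars p \<union> vars q"
  using keys_mult [of p q] by (fastforce simp: vars_def)

lemma vars_zero [simp]: "vars 0 = {}"
  by (simp add: vars_def)

lemma vars_one [simp]: "vars 1 = {}"
  by (simp add: vars_def)

lemma vars_uminus [simp]: "vars (- p) = vars (p :: _ \<Rightarrow>\<^sub>0 _::ab_group_add)"
  by (simp add: vars_def in_keys_iff)

lemma vars_const [simp]: "vars (Poly_Mapping.single {#} c) = {}"
  by (simp add: vars_def)

lemma vars_poly_var [simp]: "vars (poly_var v) = {v}"
  by (simp add: vars_def poly_var_def)

lemma vars_pdiff: "vars (pdiff v p) \<subseteq> vars p"
proof
  fix x assume "x \<in> vars (pdiff v p)"
  then obtain m where "m \<in> Poly_Mapping.keys (pdiff v p)" "x \<in># m"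
    by (auto simp: vars_def)
  then show "x \<in> vars p"
    by (auto simp: vars_def dest!: keys_pdiff intro!: bexI [of _ "add_mset v m"])
qed

lemma cring_free_comm_algebra: "cring (free_comm_algebra X)"
proof (intro cringI abelian_groupI comm_monoidI)
  show "\<exists>q\<in>carrier (free_comm_algebra X). q \<oplus>\<^bsub>free_comm_algebra X\<^esub> p = \<zero>\<^bsub>free_comm_algebra X\<^esub>"
    if "p \<in> carrier (free_comm_algebra X)" for p
    using that by (intro bexI [of _ "- p"]) (auto simp: carrier_free_comm_algebra)
qed (auto simp: carrier_free_comm_algebra algebra_simps
    dest: subsetD [OF vars_add] subsetD [OF vars_mult])

lemma minus_free_comm_algebra:
  assumes "p \<in> carrier (free_comm_algebra X)" "q \<in> carrier (free_comm_algebra X)"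
  shows "p \<ominus>\<^bsub>free_comm_algebra X\<^esub> q = p - q"
proof -
  interpret cring "free_comm_algebra X" by (rule cring_free_comm_algebra)
  have "\<ominus>\<^bsub>free_comm_algebra X\<^esub> q = - q"
    using assms by (intro minus_equality) (auto simp: carrier_free_comm_algebra)
  then show ?thesis
    by (simp add: minus_eq)
qed

lemma poly_mapping_single_add_mset:
  "Poly_Mapping.single (add_mset v m) c = poly_var v * Poly_Mapping.single m c"
  by (simp add: poly_var_def mult_single)

section \<open>The symmetric algebra as a quotient ring\<close>

locale symmetric_algebra = module scalars V
  for V :: "('k::real_normed_field, 'v, 'n) module_scheme"
begin

abbreviation P where "P \<equiv> free_comm_algebra (carrier V)"
abbreviation S where "S \<equiv> sym_algebra V"

definition proj :: "('v multiset \<Rightarrow>\<^sub>0 'k) \<Rightarrow> ('v multiset \<Rightarrow>\<^sub>0 'k) set" where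
  "proj p = sym_ideal V +>\<^bsub>P\<^esub> p"

sublocale P: cring P
  by (rule cring_free_comm_algebra)

lemma const_closed [simp, intro]: "Poly_Mapping.single {#} c \<in> carrier P"
  by (simp add: carrier_free_comm_algebra)

lemma closed_one_zero [simp, intro]: "1 \<in> carrier P" "0 \<in> carrier P"
  by (simp_all add: carrier_free_comm_algebra)

lemma closed_add_mult [simp, intro]:
  "\<lbrakk>p \<in> carrier P; q \<in> carrier P\<rbrakk> \<Longrightarrow> p + q \<in> carrier P"
  "\<lbrakk>p \<in> carrier P; q \<in> carrier P\<rbrakk> \<Longrightarrow> p * q \<in> carrier P"
  using P.a_closed [of p q] P.m_closed [of p q] by simp_all

lemma closed_uminus [simp, intro]: "p \<in> carrier P \<Longrightarrow> - p \<in> carrier P"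
  by (simp add: carrier_free_comm_algebra)

lemma poly_var_closed [simp, intro]: "v \<in> carrier V \<Longrightarrow> poly_var v \<in> carrier P"
  by (simp add: carrier_free_comm_algebra)

lemma closed_minus [simp, intro]:
  "\<lbrakk>p \<in> carrier P; q \<in> carrier P\<rbrakk> \<Longrightarrow> p - q \<in> carrier P"
  using closed_add_mult(1) [of p "- q"] by simp

lemma sym_relations_closed: "sym_relations V \<subseteq> carrier P"
  unfolding sym_relations_def by auto

sublocale I: ideal "sym_ideal V" P
  unfolding sym_ideal_def by (rule P.genideal_ideal [OF sym_relations_closed])

lemma proj_eq_iff:
  assumes "p \<in> carrier P" "q \<in> carrier P"
  shows "proj p = proj q \<longleftrightarrow> p - q \<in> sym_ideal V"
  using P.quotient_eq_iff_same_a_r_cos [OF I.is_ideal assms] assms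
  by (simp add: proj_def minus_free_comm_algebra)

lemma carrier_sym_algebra: "carrier S = proj ` carrier P"
  by (auto simp: sym_algebra_def Let_def FactRing_def A_RCOSETS_def RCOSETS_def proj_def a_r_coset_def)

lemma proj_closed [simp, intro]: "p \<in> carrier P \<Longrightarrow> proj p \<in> carrier S"
  by (simp add: carrier_sym_algebra)

lemma sym_algebra_cases:
  assumes "f \<in> carrier S" obtains p where "p \<in> carrier P" "f = proj p"
  using assms by (auto simp: carrier_sym_algebra)

lemma proj_add:
  "\<lbrakk>p \<in> carrier P; q \<in> carrier P\<rbrakk> \<Longrightarrow> proj p \<oplus>\<^bsub>S\<^esub> proj q = proj (p + q)"
  using I.a_rcos_sum [of p q] by (simp add: sym_algebra_def Let_def FactRing_def proj_def)

lemma proj_mult: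
  "\<lbrakk>p \<in> carrier P; q \<in> carrier P\<rbrakk> \<Longrightarrow> proj p \<otimes>\<^bsub>S\<^esub> proj q = proj (p * q)"
  using I.rcoset_mult_add [of p q] by (simp add: sym_algebra_def Let_def FactRing_def proj_def)

lemma proj_one: "\<one>\<^bsub>S\<^esub> = proj 1"
  by (simp add: sym_algebra_def Let_def FactRing_def proj_def)

lemma proj_zero: "\<zero>\<^bsub>S\<^esub> = proj 0"
  using P.a_rcos_zero [OF I.is_ideal I.zero_closed]
  by (simp add: sym_algebra_def Let_def FactRing_def proj_def)

lemma proj_smult:
  "p \<in> carrier P \<Longrightarrow> c \<odot>\<^bsub>S\<^esub> proj p = proj (Poly_Mapping.single {#} c * p)"
  using proj_mult [of "Poly_Mapping.single {#} c" p]
  by (simp add: sym_algebra_def Let_def FactRing_def proj_def)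

lemma cring_sym_algebra: "cring S"
proof (intro cringI abelian_groupI comm_monoidI)
  show "\<exists>g\<in>carrier S. g \<oplus>\<^bsub>S\<^esub> f = \<zero>\<^bsub>S\<^esub>" if "f \<in> carrier S" for f
    using that
  proof (cases rule: sym_algebra_cases)
    case (1 p)
    then show ?thesis
      by (intro bexI [of _ "proj (- p)"]) (simp_all add: proj_add proj_zero)
  qed
qed (auto elim!: sym_algebra_cases simp: proj_add proj_mult proj_zero proj_one algebra_simps)

sublocale S: algebra scalars S
proof (rule algebraI)
qed (use cring_scalars cring_sym_algebra in \<open>auto elim!: sym_algebra_cases
   simp: proj_smult proj_add proj_mult proj_one single_add mult_single algebra_simps\<close>)

lemma sym_incl_eq: "sym_incl V v = proj (poly_var v)"
  by (simp add: sym_incl_def proj_def)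

lemma sym_incl_closed [simp, intro]: "v \<in> carrier V \<Longrightarrow> sym_incl V v \<in> carrier S"
  by (simp add: sym_incl_eq)

lemma sym_incl_add:
  assumes "v \<in> carrier V" "w \<in> carrier V"
  shows "sym_incl V (v \<oplus>\<^bsub>V\<^esub> w) = sym_incl V v \<oplus>\<^bsub>S\<^esub> sym_incl V w"
proof -
  have "poly_var (v \<oplus>\<^bsub>V\<^esub> w) - poly_var v - poly_var w \<in> sym_relations V"
    using assms by (auto simp: sym_relations_def)
  then have "poly_var (v \<oplus>\<^bsub>V\<^esub> w) - (poly_var v + poly_var w) \<in> sym_ideal V"
    using P.genideal_self [OF sym_relations_closed] by (auto simp: sym_ideal_def diff_diff_eq)
  then show ?thesis
    using assms by (simp add: sym_incl_eq proj_add proj_eq_iff)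
qed

lemma sym_incl_smult:
  assumes "v \<in> carrier V"
  shows "sym_incl V (c \<odot>\<^bsub>V\<^esub> v) = c \<odot>\<^bsub>S\<^esub> sym_incl V v"
proof -
  have "poly_var (c \<odot>\<^bsub>V\<^esub> v) - Poly_Mapping.single {#} c * poly_var v \<in> sym_relations V"
    using assms by (auto simp: sym_relations_def)
  then have "poly_var (c \<odot>\<^bsub>V\<^esub> v) - Poly_Mapping.single {#} c * poly_var v \<in> sym_ideal V"
    using P.genideal_self [OF sym_relations_closed] by (auto simp: sym_ideal_def)
  then show ?thesis
    using assms by (simp add: sym_incl_eq proj_smult proj_eq_iff)
qed

text \<open>A monomial is built from a constant by multiplying with one variable at a time, and
  constants are the polynomials supported on the empty multiset. This is the induction principle
  demanded of the ring in \<open>generated_bracket\<close>.\<close>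

lemma sym_algebra_induct [consumes 1, case_names const add mult]:
  assumes "f \<in> carrier S"
    and const: "\<And>c. Q (c \<odot>\<^bsub>S\<^esub> \<one>\<^bsub>S\<^esub>)"
    and add: "\<And>f g. \<lbrakk>f \<in> carrier S; g \<in> carrier S; Q f; Q g\<rbrakk> \<Longrightarrow> Q (f \<oplus>\<^bsub>S\<^esub> g)"
    and mult: "\<And>v f. \<lbrakk>v \<in> carrier V; f \<in> carrier S; Q f\<rbrakk> \<Longrightarrow> Q (sym_incl V v \<otimes>\<^bsub>S\<^esub> f)"
  shows "Q f"
proof -
  have const': "Q (proj (Poly_Mapping.single {#} c))" for c
    using const [of c] by (simp add: proj_one proj_smult)
  \<comment> \<open>Membership in \<open>P\<close> is carried along because \<open>proj\<close> is
    known to respect sums and products only there.\<close>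
  have mono: "Poly_Mapping.single m c \<in> carrier P \<and> Q (proj (Poly_Mapping.single m c))"
    if "set_mset m \<subseteq> carrier V" for m c
    using that
  proof (induction m)
    case empty
    then show ?case by (simp add: const')
  next
    case (add v m)
    then show ?case
      using mult [of v "proj (Poly_Mapping.single m c)"]
      by (simp add: poly_mapping_single_add_mset sym_incl_eq proj_mult)
  qed
  obtain p where p: "p \<in> carrier P" "f = proj p"
    using assms(1) by (rule sym_algebra_cases)
  have "p \<in> carrier P \<and> Q (proj p)"
  proof (induction p rule: poly_mapping_monomial_induct)
    case (monomial m c)
    then show ?case
      using p by (intro mono) (auto simp: carrier_free_comm_algebra vars_def)
  next
    case (add p q)
    then show ?case
      using assms(3) [of "proj p" "proj q"] by (simp add: proj_add)
  next
    case zero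
    then show ?case
      using const' [of 0] by simp
  qed
  then show ?thesis
    using p by simp
qed


text \<open>The universal property of derivations on the symmetric algebra, for a linear map
  \<open>u\<close> into any module. On polynomials \<open>D\<close> is a derivation along
  \<open>proj\<close>. On a multiple \<open>q * r\<close> of a relation it is \<open>proj q\<close>
  times \<open>D r\<close>, since \<open>proj r\<close> is zero, so it descends as soon as it kills
  the relations; that is the linearity of \<open>u\<close>.\<close>

lemma ex_derivation:
  assumes "module S T" and u_closed: "\<And>v. v \<in> carrier V \<Longrightarrow> u v \<in> carrier T"
    and u_add: "\<And>v w. \<lbrakk>v \<in> carrier V; w \<in> carrier V\<rbrakk> \<Longrightarrow> u (v \<oplus>\<^bsub>V\<^esub> w) = u v \<oplus>\<^bsub>T\<^esub> u w"
    and u_smult: "\<And>c v. v \<in> carrier V \<Longrightarrow> u (c \<odot>\<^bsub>V\<^esub> v) = res_smult S T c (u v)"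
  shows "\<exists>d. derivation scalars S T d \<and> (\<forall>v\<in>carrier V. d (sym_incl V v) = u v)"
proof -
  interpret T: module S T by fact
  have pdiff_closed [simp, intro]: "pdiff v p \<in> carrier P" if "p \<in> carrier P" for v p
    using that vars_pdiff [of v p] by (auto simp: carrier_free_comm_algebra)
  define D where "D p = (\<Oplus>\<^bsub>T\<^esub>v\<in>vars p. proj (pdiff v p) \<odot>\<^bsub>T\<^esub> u v)" for p
  \<comment> \<open>There may be infinitely many variables, so \<open>D\<close> sums over those that
    occur. Enlarging the index set gives \<open>p\<close>, \<open>q\<close> and \<open>p + q\<close>
    or \<open>p * q\<close> a common range of summation.\<close>
  have D_eq: "D p = (\<Oplus>\<^bsub>T\<^esub>v\<in>W. proj (pdiff v p) \<odot>\<^bsub>T\<^esub> u v)"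
    if "p \<in> carrier P" "vars p \<subseteq> W" "W \<subseteq> carrier V" "finite W" for p W
    unfolding D_def
  proof (rule T.M.add.finprod_mono_neutral_cong_left)
    show "proj (pdiff v p) \<odot>\<^bsub>T\<^esub> u v = \<zero>\<^bsub>T\<^esub>" if "v \<in> W - vars p" for v
      using that \<open>W \<subseteq> carrier V\<close> u_closed by (auto simp: pdiff_eq_zero proj_zero [symmetric])
  qed (use that u_closed in auto)
  have D_closed [simp, intro]: "D p \<in> carrier T" if "p \<in> carrier P" for p
  proof -
    have "vars p \<subseteq> carrier V"
      using that by (simp add: carrier_free_comm_algebra)
    then show ?thesis
      unfolding D_def using that u_closed by (intro T.M.finsum_closed) auto
  qed
  have term_closed: "(\<lambda>v. proj (pdiff v p) \<odot>\<^bsub>T\<^esub> u v) \<in> W \<rightarrow> carrier T"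
    if "p \<in> carrier P" "W \<subseteq> carrier V" for p W
    using that u_closed by auto
  have D_add: "D (p + q) = D p \<oplus>\<^bsub>T\<^esub> D q" if "p \<in> carrier P" "q \<in> carrier P" for p q
  proof -
    let ?W = "vars p \<union> vars q"
    have W: "?W \<subseteq> carrier V" "vars (p + q) \<subseteq> ?W"
      using that vars_add [of p q] by (auto simp: carrier_free_comm_algebra)
    have "D (p + q) = (\<Oplus>\<^bsub>T\<^esub>v\<in>?W. proj (pdiff v p) \<odot>\<^bsub>T\<^esub> u v \<oplus>\<^bsub>T\<^esub> proj (pdiff v q) \<odot>\<^bsub>T\<^esub> u v)"
      unfolding D_eq [OF closed_add_mult(1) [OF that] W(2,1) finite_UnI [OF finite_vars finite_vars]]
      using that W u_closed
      by (intro T.M.finsum_cong') (auto simp: pdiff_add proj_add [symmetric] T.smult_l_distr)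
    also have "\<dots> = D p \<oplus>\<^bsub>T\<^esub> D q"
      using that W(1) D_eq [of p ?W] D_eq [of q ?W] T.M.finsum_addf [OF term_closed term_closed]
      by simp
    finally show ?thesis .
  qed
  have D_mult: "D (p * q) = proj p \<odot>\<^bsub>T\<^esub> D q \<oplus>\<^bsub>T\<^esub> proj q \<odot>\<^bsub>T\<^esub> D p"
    if "p \<in> carrier P" "q \<in> carrier P" for p q
  proof -
    let ?W = "vars p \<union> vars q"
    have W: "?W \<subseteq> carrier V" "vars (p * q) \<subseteq> ?W"
      using that vars_mult [of p q] by (auto simp: carrier_free_comm_algebra)
    have "D (p * q) = (\<Oplus>\<^bsub>T\<^esub>v\<in>?W. proj p \<odot>\<^bsub>T\<^esub> (proj (pdiff v q) \<odot>\<^bsub>T\<^esub> u v)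
        \<oplus>\<^bsub>T\<^esub> proj q \<odot>\<^bsub>T\<^esub> (proj (pdiff v p) \<odot>\<^bsub>T\<^esub> u v))"
      unfolding D_eq [OF closed_add_mult(2) [OF that] W(2,1) finite_UnI [OF finite_vars finite_vars]]
      using that W u_closed
      by (intro T.M.finsum_cong')
        (auto simp: pdiff_mult proj_add [symmetric] proj_mult [symmetric] T.smult_l_distr T.smult_assoc1)
    also have "\<dots> = proj p \<odot>\<^bsub>T\<^esub> D q \<oplus>\<^bsub>T\<^esub> proj q \<odot>\<^bsub>T\<^esub> D p"
      using that W(1) D_eq [of p ?W] D_eq [of q ?W] term_closed [of _ ?W]
      by (subst T.M.finsum_addf) (auto simp: T.finsum_smult_ldistr Pi_iff)
    finally show ?thesis .
  qed
  have D_const: "D (Poly_Mapping.single {#} c) = \<zero>\<^bsub>T\<^esub>" for c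
    by (simp add: D_def)
  have D_zero: "D 0 = \<zero>\<^bsub>T\<^esub>"
    by (simp add: D_def)
  have D_var: "D (poly_var v) = u v" if "v \<in> carrier V" for v
    using that u_closed by (simp add: D_def pdiff_single poly_var_def vars_def proj_one [symmetric])
  have D_cmult: "D (Poly_Mapping.single {#} c * p) = res_smult S T c (D p)" if "p \<in> carrier P" for c p
    using that by (simp add: D_mult D_const res_smult_def proj_one proj_smult)
  have D_minus: "D (p - q) = D p \<ominus>\<^bsub>T\<^esub> D q" if "p \<in> carrier P" "q \<in> carrier P" for p q
    using D_add [of "p - q" q] that by (simp add: T.M.minus_eq T.M.a_assoc T.M.r_neg)
  \<comment> \<open>The kernel of \<open>D\<close> alone need not absorb products, since
    \<open>D (q * p)\<close> contains \<open>proj p\<close> times \<open>D q\<close>. Inside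
    \<open>sym_ideal V\<close> this term is zero, so the intersection is an ideal, and minimality of
    the generated ideal applies to it.\<close>
  define J where "J = {p \<in> sym_ideal V. D p = \<zero>\<^bsub>T\<^esub>}"
  have J_carrier: "p \<in> carrier P" if "p \<in> J" for p
    using that I.a_Hcarr by (simp add: J_def)
  have proj_J: "proj p = \<zero>\<^bsub>S\<^esub>" if "p \<in> J" for p
    using that proj_eq_iff [of p 0] J_carrier [OF that] by (simp add: J_def proj_zero)
  have "ideal J P"
  proof (rule idealI)
    show "ring P" by (rule P.ring_axioms)
    show "subgroup J (add_monoid P)"
    proof (rule P.add.subgroupI)
      show "J \<subseteq> carrier P" using J_carrier by auto
      show "J \<noteq> {}" using I.zero_closed D_zero by (auto simp: J_def)
      show "\<ominus>\<^bsub>P\<^esub> p \<in> J" if "p \<in> J" for p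
      proof -
        have "\<ominus>\<^bsub>P\<^esub> p = - p"
          using minus_free_comm_algebra [of 0 "carrier V" p] J_carrier [OF that] P.a_inv_closed [of p]
          by (simp add: P.minus_eq)
        then show ?thesis
          using that I.a_inv_closed [of p] D_minus [of 0 p] J_carrier [OF that]
          by (simp add: J_def D_zero T.M.minus_eq)
      qed
      show "p \<oplus>\<^bsub>P\<^esub> q \<in> J" if "p \<in> J" "q \<in> J" for p q
        using that I.a_closed [of p q] D_add J_carrier by (simp add: J_def)
    qed
    show "q \<otimes>\<^bsub>P\<^esub> p \<in> J" if "p \<in> J" "q \<in> carrier P" for p q
      using that I.I_l_closed [of p q] J_carrier [OF that(1)] proj_J [OF that(1)]
      by (simp add: J_def D_mult)
    show "p \<otimes>\<^bsub>P\<^esub> q \<in> J" if "p \<in> J" "q \<in> carrier P" for p q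
      using that I.I_r_closed [of p q] J_carrier [OF that(1)] proj_J [OF that(1)]
      by (simp add: J_def D_mult)
  qed
  moreover have "sym_relations V \<subseteq> J"
  proof -
    have D_sum: "D (poly_var (v \<oplus>\<^bsub>V\<^esub> w) - poly_var v - poly_var w) = \<zero>\<^bsub>T\<^esub>"
      if "v \<in> carrier V" "w \<in> carrier V" for v w
      using that u_closed by (simp add: D_minus D_var u_add T.M.add_minus_minus_eq_zero)
    have D_scaled: "D (poly_var (c \<odot>\<^bsub>V\<^esub> v) - Poly_Mapping.single {#} c * poly_var v) = \<zero>\<^bsub>T\<^esub>"
      if "v \<in> carrier V" for c v
      using that u_closed by (simp add: D_minus D_var D_cmult u_smult T.M.minus_eq T.M.r_neg res_smult_def)
    have "D r = \<zero>\<^bsub>T\<^esub>" if "r \<in> sym_relations V" for r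
      using that unfolding sym_relations_def by (auto simp: D_sum D_scaled)
    moreover have "sym_relations V \<subseteq> sym_ideal V"
      unfolding sym_ideal_def by (rule P.genideal_self [OF sym_relations_closed])
    ultimately show ?thesis
      by (auto simp: J_def)
  qed
  ultimately have "sym_ideal V \<subseteq> J"
    unfolding sym_ideal_def by (rule P.genideal_minimal)
  then have D_ideal: "D p = \<zero>\<^bsub>T\<^esub>" if "p \<in> sym_ideal V" for p
    using that by (auto simp: J_def)
  have D_cong: "D p = D q" if "p \<in> carrier P" "q \<in> carrier P" "proj p = proj q" for p q
    using D_ideal [of "p - q"] D_minus [of p q] proj_eq_iff [of p q] that
      T.M.eq_of_minus_eq_zero [of "D p" "D q"] D_closed [of p] D_closed [of q]
    by simp
  define d where "d f = D (SOME p. p \<in> carrier P \<and> proj p = f)" for f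
  have d_proj: "d (proj p) = D p" if "p \<in> carrier P" for p
    unfolding d_def by (rule someI2 [of _ p]) (use that in \<open>auto intro: D_cong\<close>)
  have "derivation scalars S T d"
    unfolding derivation_def
    by (auto elim!: sym_algebra_cases
        simp: d_proj proj_add proj_smult proj_mult D_add D_mult D_const res_smult_def proj_one)
  moreover have "d (sym_incl V v) = u v" if "v \<in> carrier V" for v
    using that by (simp add: sym_incl_eq d_proj D_var)
  ultimately show ?thesis by blast
qed

end


section \<open>Tensor products\<close>

text \<open>The kernel of \<open>h\<close> is a subgroup, so it contains the subgroup generated by
  \<open>Y\<close>. This serves both for lifting maps to the tensor product and for its scalar
  multiplication.\<close>

lemma (in abelian_group) hom_generate_eq_zero:
  assumes h: "h \<in> hom (free_Abelian_group X) (add_monoid G)"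
    and rel: "Y \<subseteq> carrier (free_Abelian_group X)"
    and zero: "\<And>y. y \<in> Y \<Longrightarrow> h y = \<zero>"
    and x: "x \<in> generate (free_Abelian_group X) Y"
  shows "h x = \<zero>"
proof -
  interpret h: group_hom "free_Abelian_group X" "add_monoid G" h
    using h by (intro group_hom.intro group_hom_axioms.intro) (auto simp: a_group)
  have "generate (free_Abelian_group X) Y \<subseteq> kernel (free_Abelian_group X) (add_monoid G) h"
    using rel zero by (intro group.generate_subgroup_incl [OF group_free_Abelian_group] h.subgroup_kernel)
      (auto simp: kernel_def simp del: carrier_free_Abelian_group_iff)
  then show ?thesis
    using x by (auto simp: kernel_def)
qed

section \<open>The quotient group and its pure tensors\<close>

locale tensor_product = A: algebra K A + B: module K B
  for K :: "('k, 'm) ring_scheme" and A :: "('k, 'a, 'p) module_scheme" and B :: "('k, 'b, 'q) module_scheme"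
begin

abbreviation F where "F \<equiv> free_Abelian_group (carrier A \<times> carrier B)"
abbreviation N where "N \<equiv> tensor_kernel K A B"
abbreviation T where "T \<equiv> tensor_module K A B"
abbreviation t where "t \<equiv> pure_tensor K A B"

definition cls :: "('a \<times> 'b \<Rightarrow>\<^sub>0 int) \<Rightarrow> ('a \<times> 'b \<Rightarrow>\<^sub>0 int) set" where
  "cls x = N #>\<^bsub>F\<^esub> x"

lemma keys_diff_subset:
  "\<lbrakk>Poly_Mapping.keys x \<subseteq> X; Poly_Mapping.keys y \<subseteq> X\<rbrakk> \<Longrightarrow> Poly_Mapping.keys (x - y) \<subseteq> X"
  using keys_diff [of x y] by blast

lemma tensor_relations_closed: "tensor_relations K A B \<subseteq> carrier F"
  proof
  fix r assume "r \<in> tensor_relations K A B"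
  then show "r \<in> carrier F"
    unfolding tensor_relations_def carrier_free_Abelian_group_iff
    by (elim UnE CollectE exE conjE; hypsubst; intro keys_diff_subset) (simp_all add: keys_frag_of)
qed

sublocale F: comm_group F
  by (rule abelian_free_Abelian_group)

lemma subgroup_kernel: "subgroup N F"
  unfolding tensor_kernel_def
  by (rule F.generate_is_subgroup [OF tensor_relations_closed])

sublocale N: normal N F
  using subgroup_kernel by (simp add: F.normal_iff_subgroup)

lemma frag_add_closed [simp, intro]: "\<lbrakk>x \<in> carrier F; y \<in> carrier F\<rbrakk> \<Longrightarrow> x + y \<in> carrier F"
  using F.m_closed [of x y] by (simp del: carrier_free_Abelian_group_iff)

lemma frag_uminus_closed [simp, intro]: "x \<in> carrier F \<Longrightarrow> - x \<in> carrier F"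
  by simp

lemma frag_diff_closed [simp, intro]: "\<lbrakk>x \<in> carrier F; y \<in> carrier F\<rbrakk> \<Longrightarrow> x - y \<in> carrier F"
  using frag_add_closed [of x "- y"] by (simp del: carrier_free_Abelian_group_iff add: frag_uminus_closed)

lemma frag_zero_closed [simp, intro]: "0 \<in> carrier F"
  by simp

lemma frag_of_closed [simp, intro]: "\<lbrakk>a \<in> carrier A; b \<in> carrier B\<rbrakk> \<Longrightarrow> frag_of (a, b) \<in> carrier F"
  by (simp add: keys_frag_of)

text \<open>Unfolding membership into a condition on keys would defeat the closure rules above.\<close>

declare carrier_free_Abelian_group_iff [simp del]

lemma cls_eq_iff:
  assumes "x \<in> carrier F" "y \<in> carrier F"
  shows "cls x = cls y \<longleftrightarrow> x - y \<in> N"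
proof -
  have "x \<otimes>\<^bsub>F\<^esub> inv\<^bsub>F\<^esub> y = x - y"
    using assms by (simp add: carrier_free_Abelian_group_iff)
  then show ?thesis
    unfolding cls_def using assms F.repr_independence [OF _ _ subgroup_kernel]
      F.repr_independenceD [OF subgroup_kernel] subgroup_kernel
    by (metis F.rcos_self N.rcos_module F.is_group)
qed

lemma carrier_tensor: "carrier T = cls ` carrier F"
  by (simp add: tensor_module_def Let_def carrier_FactGroup cls_def)

lemma cls_closed [simp, intro]: "x \<in> carrier F \<Longrightarrow> cls x \<in> carrier T"
  by (simp add: carrier_tensor)

lemma tensor_cases:
  assumes "x \<in> carrier T" obtains p where "p \<in> carrier F" "x = cls p"
  using assms by (auto simp: carrier_tensor)

lemma cls_add: "\<lbrakk>x \<in> carrier F; y \<in> carrier F\<rbrakk> \<Longrightarrow> cls x \<oplus>\<^bsub>T\<^esub> cls y = cls (x + y)"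
  using N.rcos_sum [of x y] by (simp add: tensor_module_def Let_def cls_def)

lemma cls_zero: "\<zero>\<^bsub>T\<^esub> = cls 0"
  using F.coset_mult_one [of N] N.subset by (simp add: tensor_module_def Let_def cls_def)

lemma pure_tensor_eq: "t a b = cls (frag_of (a, b))"
  by (simp add: pure_tensor_def cls_def)

lemma pure_tensor_closed [simp, intro]: "\<lbrakk>a \<in> carrier A; b \<in> carrier B\<rbrakk> \<Longrightarrow> t a b \<in> carrier T"
  by (simp add: pure_tensor_eq)

lemma relation_in_kernel: "r \<in> tensor_relations K A B \<Longrightarrow> r \<in> N"
  by (simp add: tensor_kernel_def generate.incl)

lemma pure_tensor_add_left:
  assumes "a \<in> carrier A" "a' \<in> carrier A" "b \<in> carrier B"
  shows "t (a \<oplus>\<^bsub>A\<^esub> a') b = t a b \<oplus>\<^bsub>T\<^esub> t a' b"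
proof -
  have "frag_of (a \<oplus>\<^bsub>A\<^esub> a', b) - (frag_of (a, b) + frag_of (a', b)) \<in> N"
    unfolding diff_diff_eq [symmetric]
    by (rule relation_in_kernel) (use assms in \<open>auto simp: tensor_relations_def\<close>)
  then show ?thesis
    using assms by (simp add: pure_tensor_eq cls_add cls_eq_iff)
qed

lemma pure_tensor_add_right:
  assumes "a \<in> carrier A" "b \<in> carrier B" "b' \<in> carrier B"
  shows "t a (b \<oplus>\<^bsub>B\<^esub> b') = t a b \<oplus>\<^bsub>T\<^esub> t a b'"
proof -
  have "frag_of (a, b \<oplus>\<^bsub>B\<^esub> b') - (frag_of (a, b) + frag_of (a, b')) \<in> N"
    unfolding diff_diff_eq [symmetric]
    by (rule relation_in_kernel) (use assms in \<open>auto simp: tensor_relations_def\<close>)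
  then show ?thesis
    using assms by (simp add: pure_tensor_eq cls_add cls_eq_iff)
qed

lemma pure_tensor_balanced:
  assumes "c \<in> carrier K" "a \<in> carrier A" "b \<in> carrier B"
  shows "t (c \<odot>\<^bsub>A\<^esub> a) b = t a (c \<odot>\<^bsub>B\<^esub> b)"
proof -
  have "frag_of (c \<odot>\<^bsub>A\<^esub> a, b) - frag_of (a, c \<odot>\<^bsub>B\<^esub> b) \<in> N"
    by (rule relation_in_kernel) (use assms in \<open>auto simp: tensor_relations_def\<close>)
  then show ?thesis
    using assms by (simp add: pure_tensor_eq cls_eq_iff)
qed

lemma abelian_group_tensor: "abelian_group T"
proof (rule abelian_groupI)
  show "\<exists>y\<in>carrier T. y \<oplus>\<^bsub>T\<^esub> x = \<zero>\<^bsub>T\<^esub>" if "x \<in> carrier T" for x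
    using that
  proof (cases rule: tensor_cases)
    case (1 p)
    then show ?thesis
      by (intro bexI [of _ "cls (- p)"]) (simp_all add: cls_add cls_zero)
  qed
qed (auto elim!: tensor_cases simp: cls_add cls_zero algebra_simps)

sublocale T: abelian_group T
  by (rule abelian_group_tensor)

text \<open>Zero and negatives are covered by the pure case: the zero tensor is
  \<open>t \<zero> \<zero>\<close>, and the negative of \<open>t a b\<close> is
  \<open>t (\<ominus> a) b\<close>.\<close>

lemma tensor_induct [consumes 1, case_names pure add]:
  assumes "x \<in> carrier T"
    and pure: "\<And>a b. \<lbrakk>a \<in> carrier A; b \<in> carrier B\<rbrakk> \<Longrightarrow> Q (t a b)"
    and add: "\<And>x y. \<lbrakk>x \<in> carrier T; y \<in> carrier T; Q x; Q y\<rbrakk> \<Longrightarrow> Q (x \<oplus>\<^bsub>T\<^esub> y)"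
  shows "Q x"
proof -
  have cls_0: "cls 0 = t \<zero>\<^bsub>A\<^esub> \<zero>\<^bsub>B\<^esub>"
    using pure_tensor_add_left [of "\<zero>\<^bsub>A\<^esub>" "\<zero>\<^bsub>A\<^esub>" "\<zero>\<^bsub>B\<^esub>"]
    by (simp add: cls_zero [symmetric] T.add.l_cancel_one')
  have minus: "cls (- frag_of (a, b)) = t (\<ominus>\<^bsub>A\<^esub> a) b" if "a \<in> carrier A" "b \<in> carrier B" for a b
  proof -
    have "t (\<ominus>\<^bsub>A\<^esub> a) b \<oplus>\<^bsub>T\<^esub> t a b = t \<zero>\<^bsub>A\<^esub> b"
      using that by (simp add: pure_tensor_add_left [symmetric] A.M.l_neg)
    also have "\<dots> = \<zero>\<^bsub>T\<^esub>"
      using that pure_tensor_add_left [of "\<zero>\<^bsub>A\<^esub>" "\<zero>\<^bsub>A\<^esub>" b] by (simp add: T.add.l_cancel_one')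
    finally have "t (\<ominus>\<^bsub>A\<^esub> a) b \<oplus>\<^bsub>T\<^esub> t a b = cls (- frag_of (a, b)) \<oplus>\<^bsub>T\<^esub> t a b"
      using that by (simp add: cls_add cls_zero pure_tensor_eq)
    then show ?thesis
      using that by simp
  qed
  \<comment> \<open>Induction on the free abelian group has a step for differences, hence the claim
    for \<open>p\<close> and \<open>- p\<close> together.\<close>
  have "Q (cls p) \<and> Q (cls (- p)) \<and> p \<in> carrier F" if "Poly_Mapping.keys p \<subseteq> carrier A \<times> carrier B" for p
    using that
  proof (induction p rule: free_Abelian_group_induct [consumes 1, case_names zero diff frag_of])
    case zero
    then show ?case using pure [of "\<zero>\<^bsub>A\<^esub>" "\<zero>\<^bsub>B\<^esub>"] by (simp add: cls_0)
  next
    case (diff x y)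
    have "Q (cls x \<oplus>\<^bsub>T\<^esub> cls (- y))" "Q (cls (- x) \<oplus>\<^bsub>T\<^esub> cls y)"
      using diff by (auto intro!: add)
    then show ?case
      using diff by (simp add: cls_add)
  next
    case (frag_of a)
    then show ?case
      using pure by (auto simp: minus pure_tensor_eq [symmetric])
  qed
  then show ?thesis
    using assms(1) by (auto elim!: tensor_cases simp: carrier_free_Abelian_group_iff)
qed

text \<open>The universal property for maps into an abelian group. The lift is only additive, as it
  must be for the bracket, which is not linear over \<open>A\<close>.\<close>

lemma tensor_lift:
  assumes "abelian_group G"
    and closed: "\<And>a b. \<lbrakk>a \<in> carrier A; b \<in> carrier B\<rbrakk> \<Longrightarrow> \<phi> a b \<in> carrier G"
    and add_left: "\<And>a a' b. \<lbrakk>a \<in> carrier A; a' \<in> carrier A; b \<in> carrier B\<rbrakk>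
      \<Longrightarrow> \<phi> (a \<oplus>\<^bsub>A\<^esub> a') b = \<phi> a b \<oplus>\<^bsub>G\<^esub> \<phi> a' b"
    and add_right: "\<And>a b b'. \<lbrakk>a \<in> carrier A; b \<in> carrier B; b' \<in> carrier B\<rbrakk>
      \<Longrightarrow> \<phi> a (b \<oplus>\<^bsub>B\<^esub> b') = \<phi> a b \<oplus>\<^bsub>G\<^esub> \<phi> a b'"
    and balanced: "\<And>c a b. \<lbrakk>c \<in> carrier K; a \<in> carrier A; b \<in> carrier B\<rbrakk>
      \<Longrightarrow> \<phi> (c \<odot>\<^bsub>A\<^esub> a) b = \<phi> a (c \<odot>\<^bsub>B\<^esub> b)"
  obtains h where "\<And>x. x \<in> carrier T \<Longrightarrow> h x \<in> carrier G"
    and "\<And>x y. \<lbrakk>x \<in> carrier T; y \<in> carrier T\<rbrakk> \<Longrightarrow> h (x \<oplus>\<^bsub>T\<^esub> y) = h x \<oplus>\<^bsub>G\<^esub> h y"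
    and "\<And>a b. \<lbrakk>a \<in> carrier A; b \<in> carrier B\<rbrakk> \<Longrightarrow> h (t a b) = \<phi> a b"
proof -
  interpret G: abelian_group G by fact
  obtain g where g: "g \<in> hom F (add_monoid G)"
    and g_of: "\<And>x. x \<in> carrier A \<times> carrier B \<Longrightarrow> g (frag_of x) = (\<lambda>(a, b). \<phi> a b) x"
    by (rule comm_group.free_Abelian_group_universal [OF G.a_comm_group,
          of "\<lambda>(a, b). \<phi> a b" "carrier A \<times> carrier B"]) (use closed in auto)
  have g_closed: "g x \<in> carrier G" if "x \<in> carrier F" for x
    using g that by (auto simp: hom_def)
  have g_add: "g (x + y) = g x \<oplus>\<^bsub>G\<^esub> g y" if "x \<in> carrier F" "y \<in> carrier F" for x y
    using g that by (auto simp: hom_def)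
  have g_diff: "g (x - y) = g x \<ominus>\<^bsub>G\<^esub> g y" if "x \<in> carrier F" "y \<in> carrier F" for x y
    using g_add [of "x - y" y] that by (simp add: g_closed G.minus_eq G.a_assoc G.r_neg)
  have g_zero: "g x = \<zero>\<^bsub>G\<^esub>" if "x \<in> N" for x
    using g tensor_relations_closed _ that unfolding tensor_kernel_def
  proof (rule G.hom_generate_eq_zero)
    show "g r = \<zero>\<^bsub>G\<^esub>" if "r \<in> tensor_relations K A B" for r
      using that unfolding tensor_relations_def
      by (auto simp: g_diff g_of add_left add_right balanced closed G.add_minus_minus_eq_zero)
  qed
  show thesis
  proof (rule FactGroup_universal [OF g N.normal_axioms])
    show "g x = g y" if "x \<in> carrier F" "y \<in> carrier F" "N #>\<^bsub>F\<^esub> x = N #>\<^bsub>F\<^esub> y" for x y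
      using that g_zero [of "x - y"] cls_eq_iff [of x y] g_closed
        G.eq_of_minus_eq_zero [of "g x" "g y"]
      by (simp add: g_diff cls_def)
  next
    fix h assume "h \<in> hom (F Mod N) (add_monoid G)"
      and h: "\<And>x. x \<in> carrier F \<Longrightarrow> h (N #>\<^bsub>F\<^esub> x) = g x"
    show thesis
    proof
      show "h x \<in> carrier G" if "x \<in> carrier T" for x
        using that by (auto elim!: tensor_cases simp: cls_def h g_closed)
      show "h (x \<oplus>\<^bsub>T\<^esub> y) = h x \<oplus>\<^bsub>G\<^esub> h y" if "x \<in> carrier T" "y \<in> carrier T" for x y
        using that by (auto elim!: tensor_cases simp: cls_add) (simp add: cls_def h g_add)
      show "h (t a b) = \<phi> a b" if "a \<in> carrier A" "b \<in> carrier B" for a b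
        using that by (simp add: pure_tensor_def h g_of)
    qed
  qed
qed


section \<open>The module structure\<close>

definition scale :: "'a \<Rightarrow> ('a \<times> 'b \<Rightarrow>\<^sub>0 int) \<Rightarrow> ('a \<times> 'b \<Rightarrow>\<^sub>0 int)" where
  "scale f = frag_extend (\<lambda>(a, b). frag_of (f \<otimes>\<^bsub>A\<^esub> a, b))"

lemma scale_frag_of: "scale f (frag_of (a, b)) = frag_of (f \<otimes>\<^bsub>A\<^esub> a, b)"
  by (simp add: scale_def)

lemma scale_add: "scale f (x + y) = scale f x + scale f y"
  by (simp add: scale_def frag_extend_add)

lemma scale_diff: "scale f (x - y) = scale f x - scale f y"
  by (simp add: scale_def frag_extend_diff)

lemma scale_closed [simp, intro]:
  assumes "f \<in> carrier A" "x \<in> carrier F"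
  shows "scale f x \<in> carrier F"
  using keys_frag_extend [of "\<lambda>(a, b). frag_of (f \<otimes>\<^bsub>A\<^esub> a, b)" x] assms
  by (fastforce simp: scale_def carrier_free_Abelian_group_iff keys_frag_of)

text \<open>Scaling the first factor by \<open>f\<close> takes relations to relations, the balancing
  ones because \<open>f\<close> commutes with scalars in the algebra \<open>A\<close>. As scaling
  followed by \<open>cls\<close> is a homomorphism, it kills the generated subgroup.\<close>

lemma cls_scale_kernel:
  assumes f: "f \<in> carrier A" and x: "x \<in> N"
  shows "cls (scale f x) = \<zero>\<^bsub>T\<^esub>"
  using _ tensor_relations_closed _ x unfolding tensor_kernel_def
proof (rule T.hom_generate_eq_zero)
  show "(\<lambda>x. cls (scale f x)) \<in> hom F (add_monoid T)"
    using f by (auto simp: hom_def scale_add cls_add)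
  have cls_diff: "cls (x - y) = cls x \<ominus>\<^bsub>T\<^esub> cls y" if "x \<in> carrier F" "y \<in> carrier F" for x y
    using cls_add [of "x - y" y, symmetric] that by (simp add: T.minus_eq T.a_assoc T.r_neg)
  show "cls (scale f r) = \<zero>\<^bsub>T\<^esub>" if "r \<in> tensor_relations K A B" for r
  proof -
    have pure: "cls (frag_of (a, b)) = t a b" for a b
      by (simp add: pure_tensor_eq)
    have balanced: "t (f \<otimes>\<^bsub>A\<^esub> (c \<odot>\<^bsub>A\<^esub> a)) b = t (f \<otimes>\<^bsub>A\<^esub> a) (c \<odot>\<^bsub>B\<^esub> b)"
      if "c \<in> carrier K" "a \<in> carrier A" "b \<in> carrier B" for c a b
    proof -
      have "f \<otimes>\<^bsub>A\<^esub> (c \<odot>\<^bsub>A\<^esub> a) = c \<odot>\<^bsub>A\<^esub> (f \<otimes>\<^bsub>A\<^esub> a)"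
        using that f by (simp add: A.m_comm [of f] A.smult_assoc2)
      then show ?thesis
        using that f by (simp add: pure_tensor_balanced)
    qed
    show ?thesis
      using that f unfolding tensor_relations_def
      by (elim UnE CollectE exE conjE) (simp_all add: scale_diff scale_frag_of cls_diff pure balanced A.r_distr
          pure_tensor_add_left pure_tensor_add_right T.add_minus_minus_eq_zero)
  qed
qed

text \<open>The product is defined as a union over all representatives of the coset. By
  \<open>cls_scale_kernel\<close> each contributes the same coset, so the union collapses to
  it.\<close>

lemma smult_cls:
  assumes f: "f \<in> carrier A" and x: "x \<in> carrier F"
  shows "f \<odot>\<^bsub>T\<^esub> cls x = cls (scale f x)"
proof -
  have "cls (scale f y) = cls (scale f x)" if "y \<in> cls x" for y
  proof -
    have y: "y \<in> carrier F"
      using that x N.subset F.r_coset_subset_G unfolding cls_def by blast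
    have "cls x = cls y"
      using that x F.repr_independence [OF _ _ subgroup_kernel] unfolding cls_def by blast
    then have "x - y \<in> N"
      using x y cls_eq_iff by blast
    then have "cls (scale f x) = cls (scale f (x - y)) \<oplus>\<^bsub>T\<^esub> cls (scale f y)"
      using f x y by (simp add: cls_add scale_diff)
    then show ?thesis
      using f x y \<open>x - y \<in> N\<close> by (simp add: cls_scale_kernel)
  qed
  moreover have "x \<in> cls x"
    unfolding cls_def using x by (rule F.rcos_self [OF _ subgroup_kernel])
  moreover have "f \<odot>\<^bsub>T\<^esub> cls x = (\<Union>y\<in>cls x. cls (scale f y))"
    by (simp add: tensor_module_def Let_def cls_def scale_def)
  ultimately show ?thesis
    by blast
qed

lemma smult_pure_tensor:
  "\<lbrakk>f \<in> carrier A; a \<in> carrier A; b \<in> carrier B\<rbrakk> \<Longrightarrow> f \<odot>\<^bsub>T\<^esub> t a b = t (f \<otimes>\<^bsub>A\<^esub> a) b"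
  by (simp add: pure_tensor_eq smult_cls scale_frag_of)

theorem module_tensor: "module A T"
proof (rule moduleI)
  show "cring A" by (rule A.M_cring)
  show "abelian_group T" by (rule abelian_group_tensor)
  show closed: "f \<odot>\<^bsub>T\<^esub> x \<in> carrier T" if "f \<in> carrier A" "x \<in> carrier T" for f x
    using that by (auto elim!: tensor_cases simp: smult_cls)
  show add: "f \<odot>\<^bsub>T\<^esub> (x \<oplus>\<^bsub>T\<^esub> y) = f \<odot>\<^bsub>T\<^esub> x \<oplus>\<^bsub>T\<^esub> f \<odot>\<^bsub>T\<^esub> y"
    if "f \<in> carrier A" "x \<in> carrier T" "y \<in> carrier T" for f x y
    using that by (auto elim!: tensor_cases simp: smult_cls cls_add scale_add)
  \<comment> \<open>This distributive law fails for formal sums of pairs and holds only modulo the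
    relations, so it is checked on pure tensors.\<close>
  show "(f \<oplus>\<^bsub>A\<^esub> g) \<odot>\<^bsub>T\<^esub> x = f \<odot>\<^bsub>T\<^esub> x \<oplus>\<^bsub>T\<^esub> g \<odot>\<^bsub>T\<^esub> x"
    if "f \<in> carrier A" "g \<in> carrier A" "x \<in> carrier T" for f g x
    using that(3)
    by (induction rule: tensor_induct)
      (use that(1,2) in \<open>auto simp: smult_pure_tensor pure_tensor_add_left A.l_distr add closed T.a_ac\<close>)
  show "(f \<otimes>\<^bsub>A\<^esub> g) \<odot>\<^bsub>T\<^esub> x = f \<odot>\<^bsub>T\<^esub> (g \<odot>\<^bsub>T\<^esub> x)"
    if "f \<in> carrier A" "g \<in> carrier A" "x \<in> carrier T" for f g x
    using that(3)
    by (induction rule: tensor_induct)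
      (use that(1,2) in \<open>auto simp: smult_pure_tensor A.m_assoc add closed\<close>)
  show "\<one>\<^bsub>A\<^esub> \<odot>\<^bsub>T\<^esub> x = x" if "x \<in> carrier T" for x
    using that by (induction rule: tensor_induct) (auto simp: smult_pure_tensor add)
qed

section \<open>Biadditive maps on the tensor product\<close>

lemma biadditive_pure_tensor_unique:
  assumes h: "biadditive T G h" and h': "biadditive T G h'"
    and eq: "\<And>a b a' b'. \<lbrakk>a \<in> carrier A; b \<in> carrier B; a' \<in> carrier A; b' \<in> carrier B\<rbrakk>
      \<Longrightarrow> h (t a b) (t a' b') = h' (t a b) (t a' b')"
    and x: "x \<in> carrier T" and y: "y \<in> carrier T"
  shows "h x y = h' x y"
  using x
proof (induction rule: tensor_induct)
  case (pure a b)
  show ?case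
    using y
    by (induction rule: tensor_induct)
      (use pure h h' in \<open>auto simp: eq biadditive_def\<close>)
next
  case (add x x')
  then show ?case
    using h h' y by (auto simp: biadditive_def)
qed

text \<open>Two applications of \<open>tensor_lift\<close>: \<open>g a b\<close> lifts in the second
  pair for a fixed first pair, and \<open>H y\<close> then lifts \<open>g a b y\<close> in
  \<open>(a, b)\<close> for a fixed tensor \<open>y\<close>. What is known of a chosen lift fixes it
  on all tensors, so its dependence on the parameters can be tested on pure tensors.\<close>

theorem ex_biadditive:
  assumes "abelian_group G"
    and closed: "\<And>a b a' b'. \<lbrakk>a \<in> carrier A; b \<in> carrier B; a' \<in> carrier A; b' \<in> carrier B\<rbrakk>
      \<Longrightarrow> \<phi> a b a' b' \<in> carrier G"
    and add1: "\<And>a c b a' b'. \<lbrakk>a \<in> carrier A; c \<in> carrier A; b \<in> carrier B; a' \<in> carrier A; b' \<in> carrier B\<rbrakk>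
      \<Longrightarrow> \<phi> (a \<oplus>\<^bsub>A\<^esub> c) b a' b' = \<phi> a b a' b' \<oplus>\<^bsub>G\<^esub> \<phi> c b a' b'"
    and add2: "\<And>a b e a' b'. \<lbrakk>a \<in> carrier A; b \<in> carrier B; e \<in> carrier B; a' \<in> carrier A; b' \<in> carrier B\<rbrakk>
      \<Longrightarrow> \<phi> a (b \<oplus>\<^bsub>B\<^esub> e) a' b' = \<phi> a b a' b' \<oplus>\<^bsub>G\<^esub> \<phi> a e a' b'"
    and add3: "\<And>a b a' c b'. \<lbrakk>a \<in> carrier A; b \<in> carrier B; a' \<in> carrier A; c \<in> carrier A; b' \<in> carrier B\<rbrakk>
      \<Longrightarrow> \<phi> a b (a' \<oplus>\<^bsub>A\<^esub> c) b' = \<phi> a b a' b' \<oplus>\<^bsub>G\<^esub> \<phi> a b c b'"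
    and add4: "\<And>a b a' b' e. \<lbrakk>a \<in> carrier A; b \<in> carrier B; a' \<in> carrier A; b' \<in> carrier B; e \<in> carrier B\<rbrakk>
      \<Longrightarrow> \<phi> a b a' (b' \<oplus>\<^bsub>B\<^esub> e) = \<phi> a b a' b' \<oplus>\<^bsub>G\<^esub> \<phi> a b a' e"
    and balanced1: "\<And>k a b a' b'. \<lbrakk>k \<in> carrier K; a \<in> carrier A; b \<in> carrier B; a' \<in> carrier A; b' \<in> carrier B\<rbrakk>
      \<Longrightarrow> \<phi> (k \<odot>\<^bsub>A\<^esub> a) b a' b' = \<phi> a (k \<odot>\<^bsub>B\<^esub> b) a' b'"
    and balanced2: "\<And>k a b a' b'. \<lbrakk>k \<in> carrier K; a \<in> carrier A; b \<in> carrier B; a' \<in> carrier A; b' \<in> carrier B\<rbrakk>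
      \<Longrightarrow> \<phi> a b (k \<odot>\<^bsub>A\<^esub> a') b' = \<phi> a b a' (k \<odot>\<^bsub>B\<^esub> b')"
  obtains h where "biadditive T G h"
    and "\<And>a b a' b'. \<lbrakk>a \<in> carrier A; b \<in> carrier B; a' \<in> carrier A; b' \<in> carrier B\<rbrakk>
      \<Longrightarrow> h (t a b) (t a' b') = \<phi> a b a' b'"
proof -
  interpret G: abelian_group G by fact
  define lift where "lift a b h \<longleftrightarrow> (\<forall>y\<in>carrier T. h y \<in> carrier G) \<and>
      (\<forall>x\<in>carrier T. \<forall>y\<in>carrier T. h (x \<oplus>\<^bsub>T\<^esub> y) = h x \<oplus>\<^bsub>G\<^esub> h y) \<and>
      (\<forall>a'\<in>carrier A. \<forall>b'\<in>carrier B. h (t a' b') = \<phi> a b a' b')" for a b h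
  define g where "g a b = (SOME h. lift a b h)" for a b
  have g: "lift a b (g a b)" if ab: "a \<in> carrier A" "b \<in> carrier B" for a b
    unfolding g_def
  proof (rule someI_ex [of "lift a b"])
    show "\<exists>h. lift a b h"
    proof (rule tensor_lift [of G "\<phi> a b"])
      fix h
      assume "\<And>x. x \<in> carrier T \<Longrightarrow> h x \<in> carrier G"
        and "\<And>x y. \<lbrakk>x \<in> carrier T; y \<in> carrier T\<rbrakk> \<Longrightarrow> h (x \<oplus>\<^bsub>T\<^esub> y) = h x \<oplus>\<^bsub>G\<^esub> h y"
        and "\<And>a' b'. \<lbrakk>a' \<in> carrier A; b' \<in> carrier B\<rbrakk> \<Longrightarrow> h (t a' b') = \<phi> a b a' b'"
      then show "\<exists>h. lift a b h"
        by (intro exI [of _ h]) (simp add: lift_def)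
    qed (use ab \<open>abelian_group G\<close> in \<open>auto simp: closed add3 add4 balanced2\<close>)
  qed
  have g_closed [simp, intro]: "g a b y \<in> carrier G"
    and g_add: "y' \<in> carrier T \<Longrightarrow> g a b (y \<oplus>\<^bsub>T\<^esub> y') = g a b y \<oplus>\<^bsub>G\<^esub> g a b y'"
    if "a \<in> carrier A" "b \<in> carrier B" "y \<in> carrier T" for a b y y'
    using g [OF that(1,2)] that(3) by (auto simp: lift_def)
  have g_pure: "g a b (t a' b') = \<phi> a b a' b'"
    if "a \<in> carrier A" "b \<in> carrier B" "a' \<in> carrier A" "b' \<in> carrier B" for a b a' b'
    using g [OF that(1,2)] that(3,4) by (auto simp: lift_def)
  have g_add1: "g (a \<oplus>\<^bsub>A\<^esub> c) b y = g a b y \<oplus>\<^bsub>G\<^esub> g c b y"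
    if "a \<in> carrier A" "c \<in> carrier A" "b \<in> carrier B" "y \<in> carrier T" for a b c y
    using that(4)
    by (induction rule: tensor_induct) (use that(1-3) in \<open>auto simp: g_pure add1 g_add G.a_ac\<close>)
  have g_add2: "g a (b \<oplus>\<^bsub>B\<^esub> e) y = g a b y \<oplus>\<^bsub>G\<^esub> g a e y"
    if "a \<in> carrier A" "b \<in> carrier B" "e \<in> carrier B" "y \<in> carrier T" for a b e y
    using that(4)
    by (induction rule: tensor_induct) (use that(1-3) in \<open>auto simp: g_pure add2 g_add G.a_ac\<close>)
  have g_balanced: "g (k \<odot>\<^bsub>A\<^esub> a) b y = g a (k \<odot>\<^bsub>B\<^esub> b) y"
    if "k \<in> carrier K" "a \<in> carrier A" "b \<in> carrier B" "y \<in> carrier T" for k a b y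
    using that(4)
    by (induction rule: tensor_induct) (use that(1-3) in \<open>auto simp: g_pure balanced1 g_add\<close>)
  define lift' where "lift' y h \<longleftrightarrow> (\<forall>x\<in>carrier T. h x \<in> carrier G) \<and>
      (\<forall>x\<in>carrier T. \<forall>x'\<in>carrier T. h (x \<oplus>\<^bsub>T\<^esub> x') = h x \<oplus>\<^bsub>G\<^esub> h x') \<and>
      (\<forall>a\<in>carrier A. \<forall>b\<in>carrier B. h (t a b) = g a b y)" for y h
  define H where "H y = (SOME h. lift' y h)" for y
  have H: "lift' y (H y)" if y: "y \<in> carrier T" for y
    unfolding H_def
  proof (rule someI_ex [of "lift' y"])
    show "\<exists>h. lift' y h"
    proof (rule tensor_lift [of G "\<lambda>a b. g a b y"])
      fix h
      assume "\<And>x. x \<in> carrier T \<Longrightarrow> h x \<in> carrier G"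
        and "\<And>x y. \<lbrakk>x \<in> carrier T; y \<in> carrier T\<rbrakk> \<Longrightarrow> h (x \<oplus>\<^bsub>T\<^esub> y) = h x \<oplus>\<^bsub>G\<^esub> h y"
        and "\<And>a' b'. \<lbrakk>a' \<in> carrier A; b' \<in> carrier B\<rbrakk> \<Longrightarrow> h (t a' b') = g a' b' y"
      then show "\<exists>h. lift' y h"
        by (intro exI [of _ h]) (simp add: lift'_def)
    qed (use y \<open>abelian_group G\<close> in \<open>auto simp: g_add1 g_add2 g_balanced\<close>)
  qed
  have H_closed [simp, intro]: "H y x \<in> carrier G"
    and H_add: "x' \<in> carrier T \<Longrightarrow> H y (x \<oplus>\<^bsub>T\<^esub> x') = H y x \<oplus>\<^bsub>G\<^esub> H y x'"
    if "y \<in> carrier T" "x \<in> carrier T" for x x' y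
    using H [OF that(1)] that(2) by (auto simp: lift'_def)
  have H_pure: "H y (t a b) = g a b y"
    if "y \<in> carrier T" "a \<in> carrier A" "b \<in> carrier B" for a b y
    using H [OF that(1)] that(2,3) by (auto simp: lift'_def)
  \<comment> \<open>Additivity in the parameter \<open>y\<close> is not part of the lifting property
    of \<open>H y\<close>; it is inherited from \<open>g\<close> on pure tensors
    \<open>x\<close>.\<close>
  have H_add2: "H (y \<oplus>\<^bsub>T\<^esub> y') x = H y x \<oplus>\<^bsub>G\<^esub> H y' x"
    if "x \<in> carrier T" "y \<in> carrier T" "y' \<in> carrier T" for x y y'
    using that(1)
    by (induction rule: tensor_induct) (use that(2,3) in \<open>auto simp: H_pure g_add H_add G.a_ac\<close>)
  show thesis
  proof
    show "biadditive T G (\<lambda>x y. H y x)"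
      by (auto simp: biadditive_def H_add H_add2)
  qed (auto simp: H_pure g_pure)
qed

end


section \<open>The extension of a Leibniz algebra\<close>

lemma derivation_one:
  assumes "algebra K R" "module R E" "derivation K R E d"
  shows "d \<one>\<^bsub>R\<^esub> = \<zero>\<^bsub>E\<^esub>"
proof -
  interpret E: module R E by fact
  interpret K: algebra K R by fact
  have "d \<one>\<^bsub>R\<^esub> \<in> carrier E" and "d (\<one>\<^bsub>R\<^esub> \<otimes>\<^bsub>R\<^esub> \<one>\<^bsub>R\<^esub>) = \<one>\<^bsub>R\<^esub> \<odot>\<^bsub>E\<^esub> d \<one>\<^bsub>R\<^esub> \<oplus>\<^bsub>E\<^esub> \<one>\<^bsub>R\<^esub> \<odot>\<^bsub>E\<^esub> d \<one>\<^bsub>R\<^esub>"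
    using assms(3) E.R.one_closed unfolding derivation_def by blast+
  then show ?thesis
    by (simp add: E.M.add.l_cancel_one')
qed

text \<open>The product runs over an index set, so equal factors with different indices each
  contribute a summand. This yields the formula for the derivative of \<open>z1 ... zk\<close> from
  the Leibniz rule.\<close>

lemma derivation_finprod:
  assumes "algebra K R" "module R E" "derivation K R E d"
    and "finite A" "a \<in> A \<rightarrow> carrier R"
  shows "d (\<Otimes>\<^bsub>R\<^esub>i\<in>A. a i) = (\<Oplus>\<^bsub>E\<^esub>i\<in>A. (\<Otimes>\<^bsub>R\<^esub>j\<in>A - {i}. a j) \<odot>\<^bsub>E\<^esub> d (a i))"
proof -
  interpret E: module R E by fact
  interpret K: algebra K R by fact
  have d_closed: "d f \<in> carrier E" if "f \<in> carrier R" for f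
    using assms(3) that by (auto simp: derivation_def)
  have d_mult: "d (f \<otimes>\<^bsub>R\<^esub> g) = f \<odot>\<^bsub>E\<^esub> d g \<oplus>\<^bsub>E\<^esub> g \<odot>\<^bsub>E\<^esub> d f" if "f \<in> carrier R" "g \<in> carrier R" for f g
    using assms(3) that by (auto simp: derivation_def)
  show ?thesis
    using assms(4,5)
  proof (induction A rule: finite_induct)
    case empty
    then show ?case
      using derivation_one [OF assms(1-3)] by simp
  next
    case (insert x F)
    then have a: "a x \<in> carrier R" "a \<in> F \<rightarrow> carrier R" "\<And>i. a \<in> F - {i} \<rightarrow> carrier R"
      by auto
    have prod: "(\<Otimes>\<^bsub>R\<^esub>j\<in>insert x F - {i}. a j) = a x \<otimes>\<^bsub>R\<^esub> (\<Otimes>\<^bsub>R\<^esub>j\<in>F - {i}. a j)" if "i \<in> F" for i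
    proof -
      have "insert x F - {i} = insert x (F - {i})"
        using that insert by auto
      then show ?thesis
        using a insert by simp
    qed
    have cl: "(\<Otimes>\<^bsub>R\<^esub>j\<in>F - {i}. a j) \<odot>\<^bsub>E\<^esub> d (a i) \<in> carrier E" if "i \<in> F" for i
      using that a by (intro E.smult_closed d_closed E.R.finprod_closed) auto
    have "(\<Oplus>\<^bsub>E\<^esub>i\<in>insert x F. (\<Otimes>\<^bsub>R\<^esub>j\<in>insert x F - {i}. a j) \<odot>\<^bsub>E\<^esub> d (a i)) =
        (\<Otimes>\<^bsub>R\<^esub>j\<in>F. a j) \<odot>\<^bsub>E\<^esub> d (a x) \<oplus>\<^bsub>E\<^esub> (\<Oplus>\<^bsub>E\<^esub>i\<in>F. (\<Otimes>\<^bsub>R\<^esub>j\<in>insert x F - {i}. a j) \<odot>\<^bsub>E\<^esub> d (a i))"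
    proof (subst E.M.finsum_insert)
      have "insert x F - {x} = F"
        using insert by auto
      then show "(\<Otimes>\<^bsub>R\<^esub>j\<in>insert x F - {x}. a j) \<odot>\<^bsub>E\<^esub> d (a x) \<oplus>\<^bsub>E\<^esub>
          (\<Oplus>\<^bsub>E\<^esub>i\<in>F. (\<Otimes>\<^bsub>R\<^esub>j\<in>insert x F - {i}. a j) \<odot>\<^bsub>E\<^esub> d (a i)) =
        (\<Otimes>\<^bsub>R\<^esub>j\<in>F. a j) \<odot>\<^bsub>E\<^esub> d (a x) \<oplus>\<^bsub>E\<^esub> (\<Oplus>\<^bsub>E\<^esub>i\<in>F. (\<Otimes>\<^bsub>R\<^esub>j\<in>insert x F - {i}. a j) \<odot>\<^bsub>E\<^esub> d (a i))"
        by simp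
      show "(\<lambda>i. (\<Otimes>\<^bsub>R\<^esub>j\<in>insert x F - {i}. a j) \<odot>\<^bsub>E\<^esub> d (a i)) \<in> F \<rightarrow> carrier E"
        using insert by (intro Pi_I E.smult_closed d_closed E.R.finprod_closed) auto
      show "(\<Otimes>\<^bsub>R\<^esub>j\<in>insert x F - {x}. a j) \<odot>\<^bsub>E\<^esub> d (a x) \<in> carrier E"
        using insert by (intro E.smult_closed d_closed E.R.finprod_closed) auto
    qed (use insert in auto)
    also have "(\<Oplus>\<^bsub>E\<^esub>i\<in>F. (\<Otimes>\<^bsub>R\<^esub>j\<in>insert x F - {i}. a j) \<odot>\<^bsub>E\<^esub> d (a i)) =
        (\<Oplus>\<^bsub>E\<^esub>i\<in>F. a x \<odot>\<^bsub>E\<^esub> ((\<Otimes>\<^bsub>R\<^esub>j\<in>F - {i}. a j) \<odot>\<^bsub>E\<^esub> d (a i)))"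
      using a d_closed
      by (intro E.M.finsum_cong') (auto simp: prod E.smult_assoc1 Pi_iff intro!: E.smult_closed E.R.finprod_closed)
    also have "\<dots> = a x \<odot>\<^bsub>E\<^esub> (\<Oplus>\<^bsub>E\<^esub>i\<in>F. (\<Otimes>\<^bsub>R\<^esub>j\<in>F - {i}. a j) \<odot>\<^bsub>E\<^esub> d (a i))"
      using insert a cl by (intro E.finsum_smult_ldistr [symmetric]) auto
    also have "\<dots> = a x \<odot>\<^bsub>E\<^esub> d (\<Otimes>\<^bsub>R\<^esub>i\<in>F. a i)"
      using insert a by simp
    also have "(\<Otimes>\<^bsub>R\<^esub>j\<in>F. a j) \<odot>\<^bsub>E\<^esub> d (a x) \<oplus>\<^bsub>E\<^esub> a x \<odot>\<^bsub>E\<^esub> d (\<Otimes>\<^bsub>R\<^esub>i\<in>F. a i) =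
        a x \<odot>\<^bsub>E\<^esub> d (\<Otimes>\<^bsub>R\<^esub>i\<in>F. a i) \<oplus>\<^bsub>E\<^esub> (\<Otimes>\<^bsub>R\<^esub>j\<in>F. a j) \<odot>\<^bsub>E\<^esub> d (a x)"
      using a by (intro E.M.a_comm E.smult_closed d_closed E.R.finprod_closed)
    also have "\<dots> = d (\<Otimes>\<^bsub>R\<^esub>i\<in>insert x F. a i)"
      using insert.hyps a by (simp add: d_mult)
    finally show ?case
      by simp
  qed
qed

section \<open>The left center and the pairing of a Leibniz algebra\<close>

locale leibniz_extension = leibniz_algebra scalars L lb
  for L :: "('k::real_normed_field, 'l) module" and lb :: "'l \<Rightarrow> 'l \<Rightarrow> 'l"
begin

abbreviation "S \<equiv> center_sym L lb"
abbreviation "T \<equiv> ext_module L lb"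
abbreviation "t \<equiv> ext_tensor L lb"
abbreviation "\<iota> \<equiv> center_incl L lb"
abbreviation "u \<equiv> t \<one>\<^bsub>S\<^esub>"
abbreviation "Z \<equiv> left_center L lb"

lemma carrier_center_module [simp]: "carrier (center_module L lb) = Z"
  and add_center_module [simp]: "x \<oplus>\<^bsub>center_module L lb\<^esub> y = x \<oplus>\<^bsub>L\<^esub> y"
  and smult_center_module [simp]: "c \<odot>\<^bsub>center_module L lb\<^esub> x = c \<odot>\<^bsub>L\<^esub> x"
  by (simp_all add: center_module_def)

lemma lb_zero_left [simp]: "x \<in> carrier L \<Longrightarrow> lb \<zero>\<^bsub>L\<^esub> x = \<zero>\<^bsub>L\<^esub>"
  using lb_smult_left [of 0 "\<zero>\<^bsub>L\<^esub>" x] smult_l_null by (simp add: lb_closed)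

lemma center_closed [intro]: "z \<in> Z \<Longrightarrow> z \<in> carrier L"
  by (simp add: left_center_def)

lemma lb_center: "\<lbrakk>z \<in> Z; x \<in> carrier L\<rbrakk> \<Longrightarrow> lb z x = \<zero>\<^bsub>L\<^esub>"
  by (simp add: left_center_def)

lemma center_submodule: "submodule Z scalars L"
proof (rule submoduleI)
  show smult: "c \<odot>\<^bsub>L\<^esub> z \<in> Z" if "z \<in> Z" for c z
    using that by (simp add: left_center_def lb_smult_left)
  show "\<ominus>\<^bsub>L\<^esub> z \<in> Z" if "z \<in> Z" for z
  proof -
    have "\<ominus>\<^bsub>L\<^esub> z = (\<ominus>\<^bsub>scalars\<^esub> \<one>\<^bsub>scalars\<^esub>) \<odot>\<^bsub>L\<^esub> z"
      using that by (subst smult_l_minus) (auto simp: center_closed simp del: scalars_simps)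
    then show ?thesis
      using smult [OF that] by simp
  qed
qed (auto simp: left_center_def lb_add_left)

sublocale Z: symmetric_algebra "center_module L lb"
  unfolding symmetric_algebra_def center_module_def
  using center_submodule submodule.submodule_is_module module_axioms by blast

sublocale T: tensor_product scalars S L
  by unfold_locales

sublocale E: module S T
  by (rule T.module_tensor)

lemma pairing_closed [simp, intro]:
  "\<lbrakk>x \<in> carrier L; y \<in> carrier L\<rbrakk> \<Longrightarrow> pairing L lb x y \<in> carrier L"
  by (simp add: pairing_def lb_closed)

text \<open>Add the Leibniz identities for \<open>lb x (lb y w)\<close> and
  \<open>lb y (lb x w)\<close>: each left-hand side recurs on the right of the other, which leaves
  \<open>lb (lb x y) w \<oplus> lb (lb y x) w = \<zero>\<close>.\<close>

lemma pairing_center [simp, intro]: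
  assumes "x \<in> carrier L" "y \<in> carrier L"
  shows "pairing L lb x y \<in> Z"
proof -
  have "lb (pairing L lb x y) w = \<zero>\<^bsub>L\<^esub>" if w: "w \<in> carrier L" for w
  proof -
    let ?a = "lb x (lb y w)" and ?b = "lb y (lb x w)" and ?c = "lb (lb x y) w" and ?e = "lb (lb y x) w"
    have cl: "?a \<in> carrier L" "?b \<in> carrier L" "?c \<in> carrier L" "?e \<in> carrier L"
      using assms w by (auto intro: lb_closed)
    have b: "?b = ?e \<oplus>\<^bsub>L\<^esub> ?a" and a: "?a = ?c \<oplus>\<^bsub>L\<^esub> ?b"
      using assms w by (intro leibniz_identity; simp)+
    have "?c \<oplus>\<^bsub>L\<^esub> ?e = (?c \<oplus>\<^bsub>L\<^esub> ?b) \<ominus>\<^bsub>L\<^esub> ?a"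
      unfolding b using cl by algebra
    also have "\<dots> = \<zero>\<^bsub>L\<^esub>"
      unfolding a [symmetric] using cl by simp
    finally show ?thesis
      using assms w by (simp add: pairing_def lb_add_left lb_closed)
  qed
  then show ?thesis
    using assms by (simp add: left_center_def pairing_def lb_closed)
qed

lemma pairing_sym: "\<lbrakk>x \<in> carrier L; y \<in> carrier L\<rbrakk> \<Longrightarrow> pairing L lb x y = pairing L lb y x"
  unfolding pairing_def by (intro M.a_comm lb_closed)

lemma pairing_add:
  "\<lbrakk>x \<in> carrier L; y \<in> carrier L; w \<in> carrier L\<rbrakk>
    \<Longrightarrow> pairing L lb (x \<oplus>\<^bsub>L\<^esub> y) w = pairing L lb x w \<oplus>\<^bsub>L\<^esub> pairing L lb y w"
  "\<lbrakk>x \<in> carrier L; y \<in> carrier L; w \<in> carrier L\<rbrakk>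
    \<Longrightarrow> pairing L lb w (x \<oplus>\<^bsub>L\<^esub> y) = pairing L lb w x \<oplus>\<^bsub>L\<^esub> pairing L lb w y"
  by (simp_all add: pairing_def lb_closed lb_add_left lb_add_right M.a_ac)

lemma pairing_smult:
  "\<lbrakk>x \<in> carrier L; w \<in> carrier L\<rbrakk> \<Longrightarrow> pairing L lb (c \<odot>\<^bsub>L\<^esub> x) w = c \<odot>\<^bsub>L\<^esub> pairing L lb x w"
  "\<lbrakk>x \<in> carrier L; w \<in> carrier L\<rbrakk> \<Longrightarrow> pairing L lb w (c \<odot>\<^bsub>L\<^esub> x) = c \<odot>\<^bsub>L\<^esub> pairing L lb w x"
  by (simp_all add: pairing_def lb_closed lb_smult_left lb_smult_right smult_r_distr)

text \<open>Since \<open>pairing L lb y w\<close> is central, its bracket with \<open>x\<close> on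
  the right vanishes, and the outer pairing is just \<open>lb x\<close> of it. The Leibniz identity
  distributes \<open>lb x\<close> over both summands.\<close>

lemma pairing_invariant:
  assumes "x \<in> carrier L" "y \<in> carrier L" "w \<in> carrier L"
  shows "pairing L lb x (pairing L lb y w) = pairing L lb (lb x y) w \<oplus>\<^bsub>L\<^esub> pairing L lb y (lb x w)"
proof -
  have "pairing L lb x (pairing L lb y w) = lb x (pairing L lb y w)"
    using assms by (simp add: pairing_def [of L lb x] lb_closed lb_center pairing_center)
  also have "\<dots> = lb x (lb y w) \<oplus>\<^bsub>L\<^esub> lb x (lb w y)"
    using assms by (simp add: pairing_def lb_closed lb_add_right)
  also have "lb x (lb y w) = lb (lb x y) w \<oplus>\<^bsub>L\<^esub> lb y (lb x w)"
    using assms by (intro leibniz_identity)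
  also have "lb x (lb w y) = lb (lb x w) y \<oplus>\<^bsub>L\<^esub> lb w (lb x y)"
    using assms by (intro leibniz_identity)
  finally show ?thesis
    using assms by (simp add: pairing_def lb_closed M.a_ac)
qed

lemma incl_closed [simp, intro]: "z \<in> Z \<Longrightarrow> \<iota> z \<in> carrier S"
  using Z.sym_incl_closed by simp

lemma incl_add: "\<lbrakk>z \<in> Z; w \<in> Z\<rbrakk> \<Longrightarrow> \<iota> (z \<oplus>\<^bsub>L\<^esub> w) = \<iota> z \<oplus>\<^bsub>S\<^esub> \<iota> w"
  using Z.sym_incl_add [of z w] by simp

lemma incl_smult: "z \<in> Z \<Longrightarrow> \<iota> (c \<odot>\<^bsub>L\<^esub> z) = c \<odot>\<^bsub>S\<^esub> \<iota> z"
  using Z.sym_incl_smult [of z c] by simp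

lemma incl_zero [simp]: "\<iota> \<zero>\<^bsub>L\<^esub> = \<zero>\<^bsub>S\<^esub>"
  using incl_smult [of "\<zero>\<^bsub>L\<^esub>" 0] Z.S.smult_l_null [of "\<iota> \<zero>\<^bsub>L\<^esub>"] smult_l_null [of "\<zero>\<^bsub>L\<^esub>"]
    submodule.axioms(1) [OF center_submodule, THEN subgroup.one_closed]
  by simp

lemma smult_sym_eq: "f \<in> carrier S \<Longrightarrow> c \<odot>\<^bsub>S\<^esub> f = (c \<odot>\<^bsub>S\<^esub> \<one>\<^bsub>S\<^esub>) \<otimes>\<^bsub>S\<^esub> f"
  by (simp add: Z.S.smult_assoc2)

lemma pure_eq: "\<lbrakk>f \<in> carrier S; e \<in> carrier L\<rbrakk> \<Longrightarrow> t f e = f \<odot>\<^bsub>T\<^esub> u e"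
  by (simp add: T.smult_pure_tensor)

lemma unit_add: "\<lbrakk>e \<in> carrier L; e' \<in> carrier L\<rbrakk> \<Longrightarrow> u (e \<oplus>\<^bsub>L\<^esub> e') = u e \<oplus>\<^bsub>T\<^esub> u e'"
  by (simp add: T.pure_tensor_add_right)

lemma unit_smult: "e \<in> carrier L \<Longrightarrow> u (c \<odot>\<^bsub>L\<^esub> e) = (c \<odot>\<^bsub>S\<^esub> \<one>\<^bsub>S\<^esub>) \<odot>\<^bsub>T\<^esub> u e"
  using T.pure_tensor_balanced [of c "\<one>\<^bsub>S\<^esub>" e] by (simp add: pure_eq [of "c \<odot>\<^bsub>S\<^esub> \<one>\<^bsub>S\<^esub>"])

lemma unit_zero: "u \<zero>\<^bsub>L\<^esub> = \<zero>\<^bsub>T\<^esub>"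
  using unit_add [of "\<zero>\<^bsub>L\<^esub>" "\<zero>\<^bsub>L\<^esub>"] by (simp add: T.T.add.l_cancel_one')

section \<open>Existence of the form and of the derivation\<close>

theorem ex_ext_form: "\<exists>ip. is_ext_form L lb ip"
proof -
  let ?p = "\<lambda>e e'. \<iota> (pairing L lb e e')"
  have p: "\<And>e e'. \<lbrakk>e \<in> carrier L; e' \<in> carrier L\<rbrakk> \<Longrightarrow> ?p e e' \<in> carrier S"
    by auto
  have bal: "\<lbrakk>f \<in> carrier S; g \<in> carrier S; h \<in> carrier S\<rbrakk>
     \<Longrightarrow> (c \<odot>\<^bsub>S\<^esub> f) \<otimes>\<^bsub>S\<^esub> g \<otimes>\<^bsub>S\<^esub> h = f \<otimes>\<^bsub>S\<^esub> g \<otimes>\<^bsub>S\<^esub> (c \<odot>\<^bsub>S\<^esub> h)"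
    "\<lbrakk>f \<in> carrier S; g \<in> carrier S; h \<in> carrier S\<rbrakk>
     \<Longrightarrow> f \<otimes>\<^bsub>S\<^esub> (c \<odot>\<^bsub>S\<^esub> g) \<otimes>\<^bsub>S\<^esub> h = f \<otimes>\<^bsub>S\<^esub> g \<otimes>\<^bsub>S\<^esub> (c \<odot>\<^bsub>S\<^esub> h)" for c f g h
    unfolding smult_sym_eq [of f] smult_sym_eq [of g] smult_sym_eq [of h]
    by (simp_all add: smult_sym_eq [of f] smult_sym_eq [of g] smult_sym_eq [of h] Z.S.m_ac del: Z.S.smult_assoc2)
  show ?thesis
    by (rule T.ex_biadditive [of S "\<lambda>f e g e'. f \<otimes>\<^bsub>S\<^esub> g \<otimes>\<^bsub>S\<^esub> ?p e e'"])
      (auto simp: is_ext_form_def Let_def pairing_add pairing_smult incl_add incl_smult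
        Z.S.l_distr Z.S.r_distr bal intro: Z.S.is_abelian_group)
qed


theorem ex_ext_derivation: "\<exists>d. is_ext_derivation L lb d"
proof -
  have "\<exists>d. derivation scalars S T d \<and> (\<forall>z\<in>carrier (center_module L lb). d (\<iota> z) = u z)"
    using T.module_tensor
    by (rule Z.ex_derivation) (auto simp: unit_add unit_smult res_smult_def center_closed)
  then obtain d where d: "derivation scalars S T d" and d_incl: "\<And>z. z \<in> Z \<Longrightarrow> d (\<iota> z) = u z"
    by auto
  have "d (\<Otimes>\<^bsub>S\<^esub>i \<in> {..<k}. \<iota> (z i)) =
      (\<Oplus>\<^bsub>T\<^esub>i \<in> {..<k}. (\<Otimes>\<^bsub>S\<^esub>j \<in> {..<k} - {i}. \<iota> (z j)) \<odot>\<^bsub>T\<^esub> d (\<iota> (z i)))"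
    if "\<forall>i<k. z i \<in> Z" for k and z :: "nat \<Rightarrow> 'l"
    using that by (intro derivation_finprod [OF Z.S.algebra_axioms T.module_tensor d]) auto
  then have "is_ext_derivation L lb d"
    using d d_incl by (simp add: is_ext_derivation_def Let_def)
  then show ?thesis by blast
qed

lemma derivation_const:
  assumes "derivation scalars S T d"
  shows "d (c \<odot>\<^bsub>S\<^esub> \<one>\<^bsub>S\<^esub>) = \<zero>\<^bsub>T\<^esub>"
proof -
  have "d (c \<odot>\<^bsub>S\<^esub> \<one>\<^bsub>S\<^esub>) = res_smult S T c (d \<one>\<^bsub>S\<^esub>)"
    using assms by (simp add: derivation_def)
  then show ?thesis
    using derivation_one [OF Z.S.algebra_axioms T.module_tensor assms] by (simp add: res_smult_def)
qed

lemma ext_derivation_unique: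
  assumes d: "is_ext_derivation L lb d" and d': "is_ext_derivation L lb d'" and "f \<in> carrier S"
  shows "d' f = d f"
  using assms(3)
proof (induction f rule: Z.sym_algebra_induct)
  case (const c)
  then show ?case
    using d d' by (simp add: is_ext_derivation_def Let_def derivation_const)
next
  case (add f g)
  then show ?case
    using d d' by (simp add: is_ext_derivation_def Let_def derivation_def)
next
  case (mult v f)
  then have "\<iota> v \<in> carrier S" by simp
  with mult show ?case
    using d d' by (simp add: is_ext_derivation_def Let_def derivation_def)
qed

end

section \<open>The bracket for a given form and derivation\<close>

locale leibniz_extension_form = leibniz_extension L lb
  for L :: "('k::real_normed_field, 'l) module" and lb :: "'l \<Rightarrow> 'l \<Rightarrow> 'l" +
  fixes ip :: "(('l multiset \<Rightarrow>\<^sub>0 'k) set \<times> 'l \<Rightarrow>\<^sub>0 int) set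
      \<Rightarrow> (('l multiset \<Rightarrow>\<^sub>0 'k) set \<times> 'l \<Rightarrow>\<^sub>0 int) set \<Rightarrow> ('l multiset \<Rightarrow>\<^sub>0 'k) set"
    and d :: "('l multiset \<Rightarrow>\<^sub>0 'k) set \<Rightarrow> (('l multiset \<Rightarrow>\<^sub>0 'k) set \<times> 'l \<Rightarrow>\<^sub>0 int) set"
  assumes ext_form: "is_ext_form L lb ip" and ext_derivation: "is_ext_derivation L lb d"
begin

lemma ip_closed [simp, intro]: "\<lbrakk>x \<in> carrier T; y \<in> carrier T\<rbrakk> \<Longrightarrow> ip x y \<in> carrier S"
  and ip_add: "\<lbrakk>x \<in> carrier T; x' \<in> carrier T; y \<in> carrier T\<rbrakk>
    \<Longrightarrow> ip (x \<oplus>\<^bsub>T\<^esub> x') y = ip x y \<oplus>\<^bsub>S\<^esub> ip x' y"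
  and ip_add_right: "\<lbrakk>x \<in> carrier T; y \<in> carrier T; y' \<in> carrier T\<rbrakk>
    \<Longrightarrow> ip x (y \<oplus>\<^bsub>T\<^esub> y') = ip x y \<oplus>\<^bsub>S\<^esub> ip x y'"
  and ip_pure: "\<lbrakk>f \<in> carrier S; g \<in> carrier S; e \<in> carrier L; e' \<in> carrier L\<rbrakk>
    \<Longrightarrow> ip (t f e) (t g e') = f \<otimes>\<^bsub>S\<^esub> g \<otimes>\<^bsub>S\<^esub> \<iota> (pairing L lb e e')"
  using ext_form by (simp_all add: is_ext_form_def Let_def biadditive_def)

lemma derivation: "derivation scalars S T d"
  and d_incl: "z \<in> Z \<Longrightarrow> d (\<iota> z) = u z"
  using ext_derivation by (auto simp: is_ext_derivation_def Let_def)

lemma d_closed [simp, intro]: "f \<in> carrier S \<Longrightarrow> d f \<in> carrier T"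
  and d_add: "\<lbrakk>f \<in> carrier S; g \<in> carrier S\<rbrakk> \<Longrightarrow> d (f \<oplus>\<^bsub>S\<^esub> g) = d f \<oplus>\<^bsub>T\<^esub> d g"
  and d_mult: "\<lbrakk>f \<in> carrier S; g \<in> carrier S\<rbrakk>
    \<Longrightarrow> d (f \<otimes>\<^bsub>S\<^esub> g) = f \<odot>\<^bsub>T\<^esub> d g \<oplus>\<^bsub>T\<^esub> g \<odot>\<^bsub>T\<^esub> d f"
  using derivation by (auto simp: derivation_def res_smult_def)

lemma d_const: "d (c \<odot>\<^bsub>S\<^esub> \<one>\<^bsub>S\<^esub>) = \<zero>\<^bsub>T\<^esub>"
  by (rule derivation_const [OF derivation])

lemma d_one [simp]: "d \<one>\<^bsub>S\<^esub> = \<zero>\<^bsub>T\<^esub>"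
  by (rule derivation_one [OF Z.S.algebra_axioms T.module_tensor derivation])

lemma ip_unit: "\<lbrakk>e \<in> carrier L; e' \<in> carrier L\<rbrakk> \<Longrightarrow> ip (u e) (u e') = \<iota> (pairing L lb e e')"
  by (simp add: ip_pure)

lemma ip_sym:
  assumes "x \<in> carrier T" "y \<in> carrier T"
  shows "ip x y = ip y x"
  using assms(1)
proof (induction x rule: T.tensor_induct)
  case (pure f e)
  show ?case
    using assms(2)
    by (induction y rule: T.tensor_induct)
      (use pure in \<open>auto simp: ip_pure ip_add ip_add_right pairing_sym [of e] Z.S.m_comm [of f]\<close>)
next
  case (add x x')
  then show ?case
    using assms(2) by (simp add: ip_add ip_add_right)
qed

text \<open>\<open>is_ext_form\<close> demands biadditivity; linearity over \<open>S\<close> is read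
  off from the formula on pure tensors.\<close>

lemma ip_smult:
  assumes f: "f \<in> carrier S" and "x \<in> carrier T" "y \<in> carrier T"
  shows "ip (f \<odot>\<^bsub>T\<^esub> x) y = f \<otimes>\<^bsub>S\<^esub> ip x y"
  using assms(2)
proof (induction x rule: T.tensor_induct)
  case (pure g e)
  show ?case
    using assms(3)
  proof (induction y rule: T.tensor_induct)
    case (pure h e')
    then show ?case
      using \<open>g \<in> carrier S\<close> \<open>e \<in> carrier L\<close> f by (simp add: T.smult_pure_tensor ip_pure Z.S.m_assoc)
  next
    case (add y y')
    then show ?case
      using pure f by (simp add: ip_add_right Z.S.r_distr)
  qed
next
  case (add x x')
  then show ?case
    using assms(3) f by (simp add: ip_add E.smult_r_distr Z.S.r_distr)
qed

lemma ip_smult_right: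
  assumes "f \<in> carrier S" "x \<in> carrier T" "y \<in> carrier T"
  shows "ip x (f \<odot>\<^bsub>T\<^esub> y) = f \<otimes>\<^bsub>S\<^esub> ip x y"
  using assms ip_smult [of f y x] ip_sym [of x] by simp

lemma ip_zero_right [simp]: "x \<in> carrier T \<Longrightarrow> ip x \<zero>\<^bsub>T\<^esub> = \<zero>\<^bsub>S\<^esub>"
  using ip_smult_right [of "\<zero>\<^bsub>S\<^esub>" x "\<zero>\<^bsub>T\<^esub>"] by simp

definition pure_bracket where
  "pure_bracket f e g e' = E.bracket_terms f g (ip (u e) (u e')) (ip (u e) (d g)) (ip (u e') (d f))
    (u (lb e e')) (d f) (u e') (u e)"

text \<open>Each pure tensor is a ring element times a unit tensor \<open>u e\<close>, so the
  defining formula becomes an instance of \<open>bracket_terms\<close>, and the identities proved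
  for atoms apply.\<close>

lemma is_ext_bracket_iff:
  "is_ext_bracket L lb ip d br \<longleftrightarrow> biadditive T T br \<and>
    (\<forall>f\<in>carrier S. \<forall>g\<in>carrier S. \<forall>e\<in>carrier L. \<forall>e'\<in>carrier L.
      br (t f e) (t g e') = pure_bracket f e g e')"
proof -
  have "t (f \<otimes>\<^bsub>S\<^esub> g) (lb e e') = (f \<otimes>\<^bsub>S\<^esub> g) \<odot>\<^bsub>T\<^esub> u (lb e e')"
    "t (ip (u e) (d g) \<otimes>\<^bsub>S\<^esub> f) e' = (ip (u e) (d g) \<otimes>\<^bsub>S\<^esub> f) \<odot>\<^bsub>T\<^esub> u e'"
    "t (ip (u e') (d f) \<otimes>\<^bsub>S\<^esub> g) e = (ip (u e') (d f) \<otimes>\<^bsub>S\<^esub> g) \<odot>\<^bsub>T\<^esub> u e"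
    if "f \<in> carrier S" "g \<in> carrier S" "e \<in> carrier L" "e' \<in> carrier L" for f g e e'
    using that by (intro pure_eq; simp add: lb_closed)+
  then show ?thesis
    by (simp add: is_ext_bracket_def Let_def pure_bracket_def E.bracket_terms_def cong: ball_cong)
qed

theorem ex_ext_bracket: "\<exists>br. is_ext_bracket L lb ip d br"
proof -
  note ip_simps = ip_add ip_add_right ip_smult ip_smult_right
  have closed: "pure_bracket f e g e' \<in> carrier T"
    if "f \<in> carrier S" "e \<in> carrier L" "g \<in> carrier S" "e' \<in> carrier L" for f e g e'
    using that by (simp add: pure_bracket_def lb_closed E.bracket_terms_closed)
  have add1: "pure_bracket (f \<oplus>\<^bsub>S\<^esub> f') e g e' = pure_bracket f e g e' \<oplus>\<^bsub>T\<^esub> pure_bracket f' e g e'"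
    if "f \<in> carrier S" "f' \<in> carrier S" "e \<in> carrier L" "g \<in> carrier S" "e' \<in> carrier L" for f f' e g e'
    using that by (simp add: pure_bracket_def lb_closed d_add ip_simps E.bracket_terms_add_1)
  have add2: "pure_bracket f (e \<oplus>\<^bsub>L\<^esub> e'') g e' = pure_bracket f e g e' \<oplus>\<^bsub>T\<^esub> pure_bracket f e'' g e'"
    if "f \<in> carrier S" "e \<in> carrier L" "e'' \<in> carrier L" "g \<in> carrier S" "e' \<in> carrier L" for f e e'' g e'
    using that
    by (simp add: pure_bracket_def lb_closed lb_add_left unit_add ip_simps E.bracket_terms_add_2)
  have add3: "pure_bracket f e (g \<oplus>\<^bsub>S\<^esub> g') e' = pure_bracket f e g e' \<oplus>\<^bsub>T\<^esub> pure_bracket f e g' e'"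
    if "f \<in> carrier S" "e \<in> carrier L" "g \<in> carrier S" "g' \<in> carrier S" "e' \<in> carrier L" for f e g g' e'
    using that by (simp add: pure_bracket_def lb_closed d_add ip_simps E.bracket_terms_add_3)
  have add4: "pure_bracket f e g (e' \<oplus>\<^bsub>L\<^esub> e'') = pure_bracket f e g e' \<oplus>\<^bsub>T\<^esub> pure_bracket f e g e''"
    if "f \<in> carrier S" "e \<in> carrier L" "g \<in> carrier S" "e' \<in> carrier L" "e'' \<in> carrier L" for f e e'' g e'
    using that
    by (simp add: pure_bracket_def lb_closed lb_add_right unit_add ip_simps E.bracket_terms_add_4)
  \<comment> \<open>The scalar is replaced by the ring element \<open>c \<odot> \<one>\<close>,
    which \<open>d\<close> kills. Hence \<open>d f\<close> and \<open>ip (u e') (d f)\<close> scale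
    with \<open>f\<close>, as \<open>bracket_terms_balanced_1\<close> expects.\<close>
  have balanced1: "pure_bracket (c \<odot>\<^bsub>S\<^esub> f) e g e' = pure_bracket f (c \<odot>\<^bsub>L\<^esub> e) g e'"
    if "f \<in> carrier S" "e \<in> carrier L" "g \<in> carrier S" "e' \<in> carrier L" for c f e g e'
    unfolding pure_bracket_def smult_sym_eq [OF that(1)] using that
    by (simp add: lb_closed lb_smult_left unit_smult d_mult d_const ip_simps
        E.bracket_terms_balanced_1 del: Z.S.smult_assoc2)
  have balanced2: "pure_bracket f e (c \<odot>\<^bsub>S\<^esub> g) e' = pure_bracket f e g (c \<odot>\<^bsub>L\<^esub> e')"
    if "f \<in> carrier S" "e \<in> carrier L" "g \<in> carrier S" "e' \<in> carrier L" for c f e g e'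
    unfolding pure_bracket_def smult_sym_eq [OF that(3)] using that
    by (simp add: lb_closed lb_smult_right unit_smult d_mult d_const ip_simps
        E.bracket_terms_balanced_2 del: Z.S.smult_assoc2)
  show ?thesis
    by (rule T.ex_biadditive [OF T.abelian_group_tensor, of pure_bracket])
      (auto simp: is_ext_bracket_iff closed add1 add2 add3 add4 balanced1 balanced2)
qed

theorem courant_dorfman:
  assumes "is_ext_bracket L lb ip d br"
  shows "courant_dorfman_algebra scalars S T ip d br"
proof -
  have br: "biadditive T T br"
    and br_pure: "\<And>f g e e'. \<lbrakk>f \<in> carrier S; g \<in> carrier S; e \<in> carrier L; e' \<in> carrier L\<rbrakk>
      \<Longrightarrow> br (t f e) (t g e') = pure_bracket f e g e'"
    using assms by (simp_all add: is_ext_bracket_iff)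
  \<comment> \<open>All terms with a derivative vanish because \<open>d\<close> kills the unit, so
    on unit tensors the bracket is that of \<open>L\<close>.\<close>
  have br_unit: "br (u e) (u e') = u (lb e e')" if "e \<in> carrier L" "e' \<in> carrier L" for e e'
    using that by (simp add: br_pure pure_bracket_def E.bracket_terms_def lb_closed T.T.minus_eq)
  \<comment> \<open>With the scalar multiples of 1 as constants, the left center as ring generators
    and \<open>L\<close> as module generators, the conditions on generators become statements about
    \<open>lb\<close> and \<open>pairing\<close>: for instance \<open>d z\<close> is the unit tensor
    of a central vector.\<close>
  have "generated_bracket S T ip d br (range (\<lambda>c. c \<odot>\<^bsub>S\<^esub> \<one>\<^bsub>S\<^esub>)) (\<iota> ` Z) (u ` carrier L)"
  proof (unfold_locales)
    show "Q f"
      if "f \<in> carrier S" "\<And>c. c \<in> range (\<lambda>c. c \<odot>\<^bsub>S\<^esub> \<one>\<^bsub>S\<^esub>) \<Longrightarrow> Q c"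
        "\<And>f g. \<lbrakk>f \<in> carrier S; g \<in> carrier S; Q f; Q g\<rbrakk> \<Longrightarrow> Q (f \<oplus>\<^bsub>S\<^esub> g)"
        "\<And>z f. \<lbrakk>z \<in> \<iota> ` Z; f \<in> carrier S; Q f\<rbrakk> \<Longrightarrow> Q (z \<otimes>\<^bsub>S\<^esub> f)" for Q f
      using that(1) by (induction f rule: Z.sym_algebra_induct) (auto intro: that(2-))
    show "Q x"
      if "x \<in> carrier T" "\<And>f e. \<lbrakk>f \<in> carrier S; e \<in> u ` carrier L\<rbrakk> \<Longrightarrow> Q (f \<odot>\<^bsub>T\<^esub> e)"
        "\<And>x y. \<lbrakk>x \<in> carrier T; y \<in> carrier T; Q x; Q y\<rbrakk> \<Longrightarrow> Q (x \<oplus>\<^bsub>T\<^esub> y)" for Q x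
      using that(1)
    proof (induction x rule: T.tensor_induct)
      case (pure f e)
      then show ?case
        using that(2) [of f "u e"] pure_eq [of f e] by simp
    qed (rule that(3))
    fix e1 e2 e3 assume "e1 \<in> u ` carrier L" "e2 \<in> u ` carrier L" "e3 \<in> u ` carrier L"
    then obtain x y w where e: "e1 = u x" "e2 = u y" "e3 = u w"
      and xyw: "x \<in> carrier L" "y \<in> carrier L" "w \<in> carrier L"
      by blast
    have p: "ip e2 e3 = \<iota> (pairing L lb y w)"
      using xyw by (simp add: e ip_unit)
    show "ip e1 (d (ip e2 e3)) = ip (br e1 e2) e3 \<oplus>\<^bsub>S\<^esub> ip e2 (br e1 e3)"
      unfolding p using xyw
      by (simp add: e d_incl ip_unit br_unit lb_closed pairing_invariant incl_add)
    show "br e1 (br e2 e3) = br (br e1 e2) e3 \<oplus>\<^bsub>T\<^esub> br e2 (br e1 e3)"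
      using xyw leibniz_identity [OF xyw] by (simp add: e br_unit lb_closed unit_add)
  next
    fix e1 e2 assume "e1 \<in> u ` carrier L" "e2 \<in> u ` carrier L"
    then obtain x y where e: "e1 = u x" "e2 = u y" and xy: "x \<in> carrier L" "y \<in> carrier L"
      by blast
    show "br e1 e2 \<oplus>\<^bsub>T\<^esub> br e2 e1 = d (ip e1 e2)"
    proof -
      have "d (ip e1 e2) = u (pairing L lb x y)"
        using xy by (simp add: e ip_unit d_incl)
      then show ?thesis
        using xy by (simp add: e br_unit unit_add lb_closed pairing_def)
    qed
    show "br (f \<odot>\<^bsub>T\<^esub> e1) (g \<odot>\<^bsub>T\<^esub> e2) =
        ((f \<otimes>\<^bsub>S\<^esub> g) \<odot>\<^bsub>T\<^esub> br e1 e2 \<oplus>\<^bsub>T\<^esub> (ip e1 e2 \<otimes>\<^bsub>S\<^esub> g) \<odot>\<^bsub>T\<^esub> d f \<oplus>\<^bsub>T\<^esub> (ip e1 (d g) \<otimes>\<^bsub>S\<^esub> f) \<odot>\<^bsub>T\<^esub> e2)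
        \<ominus>\<^bsub>T\<^esub> (ip e2 (d f) \<otimes>\<^bsub>S\<^esub> g) \<odot>\<^bsub>T\<^esub> e1"
      if "f \<in> carrier S" "g \<in> carrier S" for f g
      using that xy br_pure [of f g x y] unfolding e br_unit [OF xy]
      by (simp add: pure_eq [of f] pure_eq [of g] pure_bracket_def E.bracket_terms_def)
  next
    show "ip x y = ip y x" if "x \<in> carrier T" "y \<in> carrier T" for x y
      using that by (rule ip_sym)
    show "br (d z) e = \<zero>\<^bsub>T\<^esub>" if "z \<in> \<iota> ` Z" "e \<in> u ` carrier L" for z e
      using that by (auto simp: d_incl br_unit lb_center unit_zero center_closed)
    show "ip (d z) (d z') = \<zero>\<^bsub>S\<^esub>" if "z \<in> \<iota> ` Z" "z' \<in> \<iota> ` Z" for z z'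
      using that by (auto simp: d_incl ip_unit pairing_def lb_center center_closed)
  qed (use br in \<open>auto simp: biadditive_def ip_add ip_smult d_add d_mult d_const\<close>)
  then show ?thesis
    by (rule generated_bracket_courant_dorfman [OF _ Z.S.algebra_axioms derivation]) simp
qed

end

text \<open>The bracket formula refers to the form and the derivation of its own structure. These
  are compared beforehand, after which the two brackets have the same prescribed values on pure
  tensors.\<close>

lemma (in leibniz_extension) ext_structure_unique:
  assumes "is_ext_structure L lb ip d br" "is_ext_structure L lb ip' d' br'"
    and x: "x \<in> carrier T" and y: "y \<in> carrier T"
  shows "ip' x y = ip x y \<and> br' x y = br x y"
proof -
  interpret B: leibniz_extension_form L lb ip d
    using assms(1) by unfold_locales (simp_all add: is_ext_structure_def)
  interpret B': leibniz_extension_form L lb ip' d'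
    using assms(2) by unfold_locales (simp_all add: is_ext_structure_def)
  have ip: "ip' x y = ip x y" if "x \<in> carrier T" "y \<in> carrier T" for x y
    using _ _ _ that
  proof (rule T.biadditive_pure_tensor_unique)
    show "biadditive T S ip'" "biadditive T S ip"
      using B.ext_form B'.ext_form by (simp_all add: is_ext_form_def Let_def)
  qed (simp add: B.ip_pure B'.ip_pure)
  have d: "d' f = d f" if "f \<in> carrier S" for f
    using ext_derivation_unique [OF B.ext_derivation B'.ext_derivation that] .
  have pure: "B'.pure_bracket f e g e' = B.pure_bracket f e g e'"
    if "f \<in> carrier S" "e \<in> carrier L" "g \<in> carrier S" "e' \<in> carrier L" for f e g e'
    using that by (simp add: B.pure_bracket_def B'.pure_bracket_def d ip)
  have "is_ext_bracket L lb ip d br" "is_ext_bracket L lb ip' d' br'"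
    using assms(1,2) by (simp_all add: is_ext_structure_def)
  then have br: "biadditive T T br" "biadditive T T br'"
    and br_pure: "\<And>f g e e'. \<lbrakk>f \<in> carrier S; g \<in> carrier S; e \<in> carrier L; e' \<in> carrier L\<rbrakk>
      \<Longrightarrow> br (t f e) (t g e') = B.pure_bracket f e g e'"
    "\<And>f g e e'. \<lbrakk>f \<in> carrier S; g \<in> carrier S; e \<in> carrier L; e' \<in> carrier L\<rbrakk>
      \<Longrightarrow> br' (t f e) (t g e') = B'.pure_bracket f e g e'"
    by (simp_all add: B.is_ext_bracket_iff B'.is_ext_bracket_iff)
  have "br' x y = br x y"
    by (rule T.biadditive_pure_tensor_unique [OF br(2,1) _ x y]) (simp add: br_pure pure)
  then show ?thesis
    using ip x y by simp
qed

text \<open>Agreement is asked on the carriers because the maps are total functions on the ambient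
  types, and their characterization speaks of carrier elements only. Existence and uniqueness
  together make it meaningful to speak of the structure given by the formulas.\<close>

theorem proposition5p1:
  fixes L :: "('k::real_normed_field, 'l) module"
    and lb :: "'l \<Rightarrow> 'l \<Rightarrow> 'l"
  assumes "leibniz_algebra scalars L lb"
  shows "\<exists>ip d br.
      is_ext_structure L lb ip d br \<and>
      (\<forall>ip' d' br'. is_ext_structure L lb ip' d' br' \<longrightarrow>
         (\<forall>x \<in> carrier (ext_module L lb). \<forall>y \<in> carrier (ext_module L lb).
            ip' x y = ip x y \<and> br' x y = br x y) \<and>
         (\<forall>f \<in> carrier (center_sym L lb). d' f = d f)) \<and>
      courant_dorfman_algebra scalars (center_sym L lb) (ext_module L lb) ip d br"
proof -
  interpret leibniz_extension L lb
    using assms by (rule leibniz_extension.intro)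
  obtain ip d where ip: "is_ext_form L lb ip" and d: "is_ext_derivation L lb d"
    using ex_ext_form ex_ext_derivation by blast
  interpret leibniz_extension_form L lb ip d
    using ip d by unfold_locales
  obtain br where br: "is_ext_bracket L lb ip d br"
    using ex_ext_bracket by blast
  have str: "is_ext_structure L lb ip d br"
    using ip d br by (simp add: is_ext_structure_def)
  have "(\<forall>x\<in>carrier T. \<forall>y\<in>carrier T. ip' x y = ip x y \<and> br' x y = br x y) \<and>
      (\<forall>f\<in>carrier S. d' f = d f)"
    if "is_ext_structure L lb ip' d' br'" for ip' d' br'
    using that ext_structure_unique [OF str that] ext_derivation_unique [OF d, of d']
    by (simp add: is_ext_structure_def)
  then show ?thesis
    using str courant_dorfman [OF br] by blast
qed

end
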